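(* Let $K$ be a field and let $(\rho_i)_{i\ge0}$ be an essential continuous MacLane chain of valuations on $K[x]$. Let $\nu$ be a valuation on $K[x]$ such that $\nu>\rho_i$ for all $i\ge0$. Then all MLV limit key polynomials for $(\rho_i)_{i\ge0}$ are (abstract) limit key polynomials for $\nu$.
   Context: Valuations. A valuation $\nu$ on $K[x]$ is a map $\nu\colon K[x]\to\Lambda\cup\{\infty\}$ ($\Lambda$ a totally ordered abelian group) with $\nu(fg)=\nu(f)+\nu(g)$, $\nu(f+g)\ge\min\{\nu(f),\nu(g)\}$, whose restriction to $K$ is a valuation of the field $K$; non-zero polynomials may have value $\infty$. Its value group $\Gamma_\nu$ is generated by the finite values of $\nu$; $(\Gamma_\nu)_{\mathbb Q}=\Gamma_\nu\otimes\mathbb Q$. $\mu\le\nu$ (for $\mu$ with values in a subgroup of $\Gamma_\nu$) means $\mu(f)\le\nu(f)$ for all $f\in K[x]$; $\mu<\nu$ means $\mu\le\nu$ and $\mu\ne\nu$. MLV key polynomials. Let $\mathcal P_\alpha=\{g:\nu(g)\ge\alpha\}\supset\mathcal P_\alpha^+=\{g:\nu(g)>\alpha\}$, and let $\mathcal G_\nu=\bigoplus_{\alpha\in\Gamma_\nu}\mathcal P_\alpha/\mathcal P_\alpha^+$ be the graded algebra, with $\operatorname{in}_\nu g=g+\mathcal P_{\nu(g)}^+$ if $\nu(g)<\infty$, and $\operatorname{in}_\nu g=0$ otherwise. Write $h\mid_\nu g$ if $\operatorname{in}_\nu h$ divides $\operatorname{in}_\nu g$ in $\mathcal G_\nu$.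 A MacLane-Vaquié (MLV) key polynomial for $\nu$ is a monic $g\in K[x]$ such that $(\operatorname{in}_\nu g)\mathcal G_\nu$ is a non-zero prime ideal and $g\nmid_\nu f$ for every non-zero $f$ with $\deg f<\deg g$. The set of these is $\mathrm{KP}(\nu)$. Ordinary augmentation. If $\chi\in\mathrm{KP}(\rho)$ and $\beta>\rho(\chi)$ lies in an ordered group containing $\Gamma_\rho$, then $[\rho;\chi,\beta]$ is the valuation sending $f=\sum_{s}a_s\chi^s$ ($\deg a_s<\deg\chi$) to $\min_s\{\rho(a_s)+s\beta\}$. Continuous MacLane chains. Let $\rho_0$ be a valuation with $\mathrm{KP}(\rho_0)\ne\emptyset$. A continuous MacLane chain of stable degree $m$ is a countably infinite sequence of valuations (values in a common ordered abelian group) $\rho_i=[\rho_{i-1};\chi_i,\beta_i]$, $i\ge1$, with $\chi_i\in\mathrm{KP}(\rho_{i-1})$, $\beta_i>\rho_{i-1}(\chi_i)$ finite, $\deg\chi_i=m$ and $\chi_{i+1}\nmid_{\rho_i}\chi_i$ for all $i\ge 1$. A polynomial $f$ is stable if $\rho_i(f)$ is constant for $i$ large. Let $m_\infty$ be the minimal degree of a non-stable polynomial ($\infty$ if there are none). The chain is essential if $m<m_\infty<\infty$. In this case the MLV limit key polynomials for $(\rho_i)_{i\ge0}$ are the monic non-stable polynomials of degree $m_\infty$. (Abstract) key polynomials. For $b\ge0$, $\partial_b$ is defined by $f(x+y)=\sum_{b\ge0}\partial_b(f)y^b$. For non-constant $f$ with $\nu(f)<\infty$ set $\epsilon(f)=\max_{b\ge1}\frac{\nu(f)-\nu(\partial_b(f))}{b}\in(\Gamma_\nu)_{\mathbb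 Q}$; set $\epsilon(f)=\infty$ if $\nu(f)=\infty$. A monic (non-constant) $Q\in K[x]$ is a key polynomial for $\nu$ if $0<\deg f<\deg Q$ implies $\epsilon(f)<\epsilon(Q)$, for all $f\in K[x]$. For a monic non-constant $Q$ and $f=\sum_s a_sQ^s$ with $\deg a_s<\deg Q$, put $\nu_Q(f)=\min_s\nu(a_sQ^s)$; if $Q$ is a key polynomial for $\nu$, then $\nu_Q$ is a valuation and $\nu_Q\le\nu$. For valuations $\mu<\nu$, $\Phi_{\mu,\nu}$ is the set of all monic polynomials $\phi$ of minimal degree among those satisfying $\mu(\phi)<\nu(\phi)$, and $\deg(\Phi_{\mu,\nu})$ is this degree. (Abstract) limit key polynomials. A monic polynomial $Q\in K[x]$ is a limit key polynomial for $\nu$ if there exists a key polynomial $Q_-$ for $\nu$ (with $\nu_{Q_-}<\nu$) such that: (K1) $\deg(Q_-)=\deg(\Phi_{\nu_{Q_-},\nu})$; (K2) the set $\{\nu(\chi)\mid\chi\in\Phi_{\nu_{Q_-},\nu}\}$ has no maximal element; (K3) $\nu_\chi(Q)<\nu(Q)$ for all $\chi\in\Phi_{\nu_{Q_-},\nu}$; (K4) $Q$ has minimal degree among all polynomials satisfying (K3). *)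

theory Defs
  imports
    "HOL-Computational_Algebra.Polynomial"
    "HOL-Computational_Algebra.Group_Closure"
    "HOL-Library.Extended_Nat"
    "HOL-Library.Set_Algebras"
    "HOL-Library.Poly_Mapping"
    "HOL-Algebra.QuotRing"
    "HOL-Algebra.Divisibility"
begin

section \<open>Ordered groups with infinity\<close>

datatype 'a with_infty = Fin (the_fin: 'a) | Infty

instantiation with_infty :: (linorder) linorder
begin

fun less_eq_with_infty :: "'a with_infty \<Rightarrow> 'a with_infty \<Rightarrow> bool" where
  "Fin a \<le> Fin b \<longleftrightarrow> a \<le> b"
| "Infty \<le> Fin b \<longleftrightarrow> False"
| "x \<le> Infty \<longleftrightarrow> True"

definition less_with_infty :: "'a with_infty \<Rightarrow> 'a with_infty \<Rightarrow> bool" where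
  "x < y \<longleftrightarrow> \<not> y \<le> (x :: 'a with_infty)"

instance
proof
  fix x y z :: "'a with_infty"
  show "x < y \<longleftrightarrow> x \<le> y \<and> \<not> y \<le> x"
    by (cases x; cases y) (auto simp: less_with_infty_def)
  show "x \<le> x" by (cases x) auto
  show "x \<le> y \<Longrightarrow> y \<le> z \<Longrightarrow> x \<le> z" by (cases x; cases y; cases z) auto
  show "x \<le> y \<Longrightarrow> y \<le> x \<Longrightarrow> x = y" by (cases x; cases y) auto
  show "x \<le> y \<or> y \<le> x" by (cases x; cases y) auto
qed

end

lemma less_with_infty_simps [simp]:
  "Fin a < Fin b \<longleftrightarrow> a < b" "Fin a < Infty" "\<not> Infty < x"
  by (auto simp: less_with_infty_def)

lemma le_Infty [simp]: "x \<le> Infty"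
  by (cases x) auto

instantiation with_infty :: (comm_monoid_add) comm_monoid_add
begin

fun plus_with_infty :: "'a with_infty \<Rightarrow> 'a with_infty \<Rightarrow> 'a with_infty" where
  "Fin a + Fin b = Fin (a + b)"
| "Infty + y = Infty"
| "x + Infty = Infty"

definition zero_with_infty :: "'a with_infty" where
  "0 = Fin 0"

instance
proof
  fix x y z :: "'a with_infty"
  show "x + y + z = x + (y + z)" by (cases x; cases y; cases z) (auto simp: add.assoc)
  show "x + y = y + x" by (cases x; cases y) (auto simp: add.commute)
  show "0 + x = x" by (cases x) (auto simp: zero_with_infty_def)
qed

end

lemma plus_Infty [simp]: "x + Infty = Infty"
  by (cases x) auto

instance with_infty :: (linordered_ab_group_add) ordered_comm_monoid_add
proof
  fix x y z :: "'a with_infty"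
  show "x \<le> y \<Longrightarrow> z + x \<le> z + y" by (cases x; cases y; cases z) auto
qed

definition nsmul :: "nat \<Rightarrow> 'a :: comm_monoid_add \<Rightarrow> 'a" where
  "nsmul n a = ((+) a ^^ n) 0"

lemma nsmul_0 [simp]: "nsmul 0 a = 0"
  and nsmul_Suc [simp]: "nsmul (Suc n) a = a + nsmul n a"
  by (simp_all add: nsmul_def)

lemma nsmul_add: "nsmul (m + n) a = nsmul m a + nsmul n a"
  by (induction m) (auto simp: add.assoc)

lemma nsmul_nsmul: "nsmul m (nsmul n a) = nsmul (m * n) a"
  by (induction m) (auto simp: nsmul_add)

lemma nsmul_strict_mono:
  fixes a b :: "'a :: linordered_ab_group_add"
  assumes "a < b" "n > 0"
  shows "nsmul n a < nsmul n b"
  using assms(2)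
proof (induction n)
  case (Suc n)
  then show ?case using assms(1) by (cases "n = 0") (auto intro: add_strict_mono)
qed simp

lemma nsmul_le_iff:
  fixes a b :: "'a :: linordered_ab_group_add"
  assumes "n > 0"
  shows "nsmul n a \<le> nsmul n b \<longleftrightarrow> a \<le> b"
  by (metis assms linorder_not_less nsmul_strict_mono order.strict_implies_order order_le_less)

lemma nsmul_eq_iff:
  fixes a b :: "'a :: linordered_ab_group_add"
  assumes "n > 0"
  shows "nsmul n a = nsmul n b \<longleftrightarrow> a = b"
  using nsmul_le_iff[OF assms] by (metis order.antisym order.refl)

text \<open>
  The ordered set underlying the tensor product with the rational numbers, i.e. the divisible
  hull: fractions \<open>a / m\<close> with \<open>m > 0\<close>. An ordered abelian group is torsion-free, so
  cross-multiplication needs no extra factor. Every occurring value group is a subgroup of one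
  ambient group, and its divisible hull is ordered as a subset of that of the ambient group.
\<close>

definition hull_rel :: "'a :: linordered_ab_group_add \<times> nat \<Rightarrow> 'a \<times> nat \<Rightarrow> bool" where
  "hull_rel = (\<lambda>(a, m) (b, n). m > 0 \<and> n > 0 \<and> nsmul n a = nsmul m b)"

lemma hull_le_trans:
  fixes a b c :: "'a :: linordered_ab_group_add"
  assumes "0 < m" "0 < n" "0 < k" "nsmul n a \<le> nsmul m b" "nsmul k b \<le> nsmul n c"
  shows "nsmul k a \<le> nsmul m c"
proof -
  have "nsmul n (nsmul k a) = nsmul k (nsmul n a)" by (simp add: nsmul_nsmul mult.commute)
  also have "\<dots> \<le> nsmul k (nsmul m b)" using assms nsmul_le_iff by blast
  also have "\<dots> = nsmul m (nsmul k b)" by (simp add: nsmul_nsmul mult.commute)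
  also have "\<dots> \<le> nsmul m (nsmul n c)" using assms nsmul_le_iff by blast
  also have "\<dots> = nsmul n (nsmul m c)" by (simp add: nsmul_nsmul mult.commute)
  finally show ?thesis using assms nsmul_le_iff by blast
qed

lemma hull_eq_trans:
  fixes a b c :: "'a :: linordered_ab_group_add"
  assumes "0 < m" "0 < n" "0 < k" "nsmul n a = nsmul m b" "nsmul k b = nsmul n c"
  shows "nsmul k a = nsmul m c"
  using hull_le_trans[of m n k a b c] hull_le_trans[of k n m c b a] assms
  by (intro order.antisym) auto

quotient_type (overloaded) 'a div_hull =
  "'a :: linordered_ab_group_add \<times> nat" / partial: hull_rel
proof (rule part_equivpI)
  show "\<exists>x :: 'a \<times> nat. hull_rel x x"
    by (rule exI[of _ "(0, 1)"]) (simp add: hull_rel_def)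
  show "symp (hull_rel :: 'a \<times> nat \<Rightarrow> _)"
    by (auto simp: symp_def hull_rel_def)
  show "transp (hull_rel :: 'a \<times> nat \<Rightarrow> _)"
    unfolding transp_def hull_rel_def by (auto dest: hull_eq_trans)
qed

text \<open>\<open>hull_frac a m\<close> is \<open>a / m\<close>, for \<open>m > 0\<close>.\<close>

lift_definition hull_frac :: "'a :: linordered_ab_group_add \<Rightarrow> nat \<Rightarrow> 'a div_hull"
  is "\<lambda>a m. (a, if m = 0 then 1 else m)"
  by (auto simp: hull_rel_def)

instantiation div_hull :: (linordered_ab_group_add) linorder
begin

lift_definition less_eq_div_hull :: "'a div_hull \<Rightarrow> 'a div_hull \<Rightarrow> bool"
  is "\<lambda>(a, m) (b, n). nsmul n a \<le> nsmul m b"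
proof -
  fix p q p' q' :: "'a \<times> nat"
  assume *: "hull_rel p q" "hull_rel p' q'"
  obtain a m b n a' m' b' n' where
    [simp]: "p = (a, m)" "q = (b, n)" "p' = (a', m')" "q' = (b', n')"
    by (cases p; cases q; cases p'; cases q') auto
  have pos: "m > 0" "n > 0" "m' > 0" "n' > 0"
    and 1: "nsmul n a \<le> nsmul m b" "nsmul m b \<le> nsmul n a"
    and 2: "nsmul n' a' \<le> nsmul m' b'" "nsmul m' b' \<le> nsmul n' a'"
    using * by (auto simp: hull_rel_def)
  have "nsmul m' a \<le> nsmul m a' \<longleftrightarrow> nsmul n' b \<le> nsmul n b'"
    using pos 1 2 by (meson hull_le_trans)
  then show "(case p of (a, m) \<Rightarrow> \<lambda>(b, n). nsmul n a \<le> nsmul m b) p' =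
             (case q of (a, m) \<Rightarrow> \<lambda>(b, n). nsmul n a \<le> nsmul m b) q'"
    by simp
qed

definition less_div_hull :: "'a div_hull \<Rightarrow> 'a div_hull \<Rightarrow> bool" where
  "x < y \<longleftrightarrow> \<not> y \<le> (x :: 'a div_hull)"

instance
proof
  fix x y z :: "'a div_hull"
  show lin: "x \<le> y \<or> y \<le> x" by transfer (auto simp: hull_rel_def)
  show "x < y \<longleftrightarrow> x \<le> y \<and> \<not> y \<le> x" using lin by (auto simp: less_div_hull_def)
  show "x \<le> x" by transfer auto
  show "x \<le> y \<Longrightarrow> y \<le> z \<Longrightarrow> x \<le> z"
    by transfer (auto simp: hull_rel_def intro: hull_le_trans)
  show "x \<le> y \<Longrightarrow> y \<le> x \<Longrightarrow> x = y" by transfer (auto simp: hull_rel_def)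
qed

end

lemma hull_frac_le_iff:
  "m > 0 \<Longrightarrow> n > 0 \<Longrightarrow> hull_frac a m \<le> hull_frac b n \<longleftrightarrow> nsmul n a \<le> nsmul m b"
  by transfer auto


section \<open>Valuations\<close>

definition field_valuation :: "('k :: field \<Rightarrow> 'g :: linordered_ab_group_add with_infty) \<Rightarrow> bool" where
  "field_valuation v \<longleftrightarrow>
     (\<forall>a b. v (a * b) = v a + v b) \<and>
     (\<forall>a b. min (v a) (v b) \<le> v (a + b)) \<and>
     (\<forall>a. v a = Infty \<longleftrightarrow> a = 0)"

definition valuation ::
    "('k :: field poly \<Rightarrow> 'g :: linordered_ab_group_add with_infty) \<Rightarrow> bool" where
  "valuation \<nu> \<longleftrightarrow>
     (\<forall>f g. \<nu> (f * g) = \<nu> f + \<nu> g) \<and>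
     (\<forall>f g. min (\<nu> f) (\<nu> g) \<le> \<nu> (f + g)) \<and>
     field_valuation (\<lambda>a. \<nu> [:a:])"

definition value_group ::
    "('k :: field poly \<Rightarrow> 'g :: linordered_ab_group_add with_infty) \<Rightarrow> 'g set" where
  "value_group \<nu> = group_closure {\<alpha>. \<exists>f. \<nu> f = Fin \<alpha>}"

definition val_le ::
    "('k :: field poly \<Rightarrow> 'g :: linordered_ab_group_add with_infty) \<Rightarrow>
     ('k poly \<Rightarrow> 'g with_infty) \<Rightarrow> bool" where
  "val_le \<mu> \<nu> \<longleftrightarrow> value_group \<mu> \<subseteq> value_group \<nu> \<and> (\<forall>f. \<mu> f \<le> \<nu> f)"

definition val_less ::
    "('k :: field poly \<Rightarrow> 'g :: linordered_ab_group_add with_infty) \<Rightarrow>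
     ('k poly \<Rightarrow> 'g with_infty) \<Rightarrow> bool" where
  "val_less \<mu> \<nu> \<longleftrightarrow> val_le \<mu> \<nu> \<and> \<mu> \<noteq> \<nu>"

lemma valuation_0: "valuation \<nu> \<Longrightarrow> \<nu> 0 = Infty"
  using pCons_0_0 by (metis (no_types, lifting) field_valuation_def valuation_def)

lemma valuation_1: "valuation \<nu> \<Longrightarrow> \<nu> 1 = 0"
proof -
  assume v: "valuation \<nu>"
  then have "\<nu> [:1:] \<noteq> Infty" unfolding valuation_def field_valuation_def by simp
  then obtain a where a: "\<nu> 1 = Fin a" by (cases "\<nu> 1") (auto simp: one_pCons)
  have "\<nu> (1 * 1) = \<nu> 1 + \<nu> 1" using v unfolding valuation_def by blast
  then show ?thesis using a by (simp add: zero_with_infty_def)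
qed

lemma valuation_minus: 
  assumes v: "valuation \<nu>" 
  shows "\<nu> (- f) = \<nu> f"
proof -
  have m: "\<nu> (a * b) = \<nu> a + \<nu> b" for a b using v unfolding valuation_def by blast
  have s: "\<nu> (-1) + \<nu> (-1) = Fin 0"
    using m[of "-1" "-1"] valuation_1[OF v] by (simp add: zero_with_infty_def)
  then obtain a where a: "\<nu> (-1) = Fin a" by (cases "\<nu> (-1)") auto
  have "a + a = 0" using s a by simp
  then have "\<nu> (-1) = 0" using a by (simp add: zero_with_infty_def)
  then show ?thesis using m[of "-1" f] by simp
qed


section \<open>The graded algebra\<close>

definition P_ge ::
    "('k :: field poly \<Rightarrow> 'g :: linordered_ab_group_add with_infty) \<Rightarrow> 'g \<Rightarrow> 'k poly set" where
  "P_ge \<nu> \<alpha> = {g. \<nu> g \<ge> Fin \<alpha>}"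

definition P_gt ::
    "('k :: field poly \<Rightarrow> 'g :: linordered_ab_group_add with_infty) \<Rightarrow> 'g \<Rightarrow> 'k poly set" where
  "P_gt \<nu> \<alpha> = {g. \<nu> g > Fin \<alpha>}"

text \<open>
  An element of the graded algebra is the family of its homogeneous components, each a coset in
  \<open>P_ge \<nu> \<alpha> / P_gt \<nu> \<alpha>\<close>, all but finitely many of them zero. Letting the degree run over the whole
  ambient group instead of the value group only adds trivial components: see
  \<open>P_ge_eq_P_gt\<close> below. In the product of two cosets, the sum and product of sets are
  elementwise (Minkowski); adding \<open>P_gt \<nu> \<gamma>\<close> turns the result into a full coset.
\<close>

definition gr_supp ::
    "('k :: field poly \<Rightarrow> 'g :: linordered_ab_group_add with_infty) \<Rightarrow>
     ('g \<Rightarrow> 'k poly set) \<Rightarrow> 'g set" where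
  "gr_supp \<nu> F = {\<alpha>. F \<alpha> \<noteq> P_gt \<nu> \<alpha>}"

definition graded_algebra ::
    "('k :: field poly \<Rightarrow> 'g :: linordered_ab_group_add with_infty) \<Rightarrow>
     ('g \<Rightarrow> 'k poly set) ring" where
  "graded_algebra \<nu> =
     \<lparr> carrier = {F. (\<forall>\<alpha>. \<exists>f \<in> P_ge \<nu> \<alpha>. F \<alpha> = f +o P_gt \<nu> \<alpha>) \<and> finite (gr_supp \<nu> F)},
       mult = (\<lambda>F G \<gamma>. (\<Sum>\<alpha>\<in>gr_supp \<nu> F. F \<alpha> * G (\<gamma> - \<alpha>)) + P_gt \<nu> \<gamma>),
       one = (\<lambda>\<alpha>. if \<alpha> = 0 then 1 +o P_gt \<nu> \<alpha> else P_gt \<nu> \<alpha>),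
       zero = P_gt \<nu>,
       add = (\<lambda>F G \<alpha>. F \<alpha> + G \<alpha>) \<rparr>"

definition initial ::
    "('k :: field poly \<Rightarrow> 'g :: linordered_ab_group_add with_infty) \<Rightarrow> 'k poly \<Rightarrow>
     'g \<Rightarrow> 'k poly set" where
  "initial \<nu> g = (\<lambda>\<alpha>. if \<nu> g = Fin \<alpha> then g +o P_gt \<nu> \<alpha> else P_gt \<nu> \<alpha>)"

lemma P_ge_eq_P_gt: "\<alpha> \<notin> value_group \<nu> \<Longrightarrow> P_ge \<nu> \<alpha> = P_gt \<nu> \<alpha>"
proof -
  assume "\<alpha> \<notin> value_group \<nu>"
  then have "\<nu> g \<noteq> Fin \<alpha>" for g
    unfolding value_group_def by (auto intro: group_closure.base)
  then have "Fin \<alpha> \<le> \<nu> g \<longleftrightarrow> Fin \<alpha> < \<nu> g" for g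
    by (metis order.order_iff_strict)
  then show ?thesis unfolding P_ge_def P_gt_def by simp
qed

lemma initial_Infty: "\<nu> g = Infty \<Longrightarrow> initial \<nu> g = \<zero>\<^bsub>graded_algebra \<nu>\<^esub>"
  by (simp add: initial_def graded_algebra_def)

context
  fixes \<nu> :: "'k :: field poly \<Rightarrow> 'g :: linordered_ab_group_add with_infty"
  assumes v: "valuation \<nu>"
begin

lemma val_mult: "\<nu> (f * g) = \<nu> f + \<nu> g"
  using v unfolding valuation_def by blast

lemma val_add: "min (\<nu> f) (\<nu> g) \<le> \<nu> (f + g)"
  using v unfolding valuation_def by blast

lemma P_gt_0: "0 \<in> P_gt \<nu> \<alpha>"
  by (simp add: P_gt_def valuation_0[OF v])

lemma P_gt_add: "f \<in> P_gt \<nu> \<alpha> \<Longrightarrow> g \<in> P_gt \<nu> \<alpha> \<Longrightarrow> f + g \<in> P_gt \<nu> \<alpha>"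
  unfolding P_gt_def using val_add[of f g] by (auto simp: min_def split: if_splits)

lemma P_ge_add: "f \<in> P_ge \<nu> \<alpha> \<Longrightarrow> g \<in> P_ge \<nu> \<alpha> \<Longrightarrow> f + g \<in> P_ge \<nu> \<alpha>"
  unfolding P_ge_def using val_add[of f g] by (auto simp: min_def split: if_splits)

lemma P_gt_uminus: "f \<in> P_gt \<nu> \<alpha> \<Longrightarrow> - f \<in> P_gt \<nu> \<alpha>"
  unfolding P_gt_def using valuation_minus[OF v] by auto

lemma P_ge_uminus: "f \<in> P_ge \<nu> \<alpha> \<Longrightarrow> - f \<in> P_ge \<nu> \<alpha>"
  unfolding P_ge_def using valuation_minus[OF v] by auto

lemma P_gt_diff: "f \<in> P_gt \<nu> \<alpha> \<Longrightarrow> g \<in> P_gt \<nu> \<alpha> \<Longrightarrow> f - g \<in> P_gt \<nu> \<alpha>"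
  using P_gt_add[of f \<alpha> "- g"] P_gt_uminus[of g \<alpha>] by simp

lemma P_gt_subset: "P_gt \<nu> \<alpha> \<subseteq> P_ge \<nu> \<alpha>"
  by (auto simp: P_gt_def P_ge_def)

lemma P_ge_mult: "f \<in> P_ge \<nu> \<alpha> \<Longrightarrow> g \<in> P_ge \<nu> \<beta> \<Longrightarrow> f * g \<in> P_ge \<nu> (\<alpha> + \<beta>)"
  unfolding P_ge_def by (cases "\<nu> f"; cases "\<nu> g") (auto simp: val_mult intro: add_mono)

lemma P_ge_gt_mult: "f \<in> P_ge \<nu> \<alpha> \<Longrightarrow> g \<in> P_gt \<nu> \<beta> \<Longrightarrow> f * g \<in> P_gt \<nu> (\<alpha> + \<beta>)"
  unfolding P_ge_def P_gt_def
  by (cases "\<nu> f"; cases "\<nu> g") (auto simp: val_mult intro: add_le_less_mono)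

lemma P_gt_ge_mult: "f \<in> P_gt \<nu> \<alpha> \<Longrightarrow> g \<in> P_ge \<nu> \<beta> \<Longrightarrow> f * g \<in> P_gt \<nu> (\<alpha> + \<beta>)"
  using P_ge_gt_mult[of g \<beta> f \<alpha>] by (simp add: mult.commute add.commute)

lemma coset_mem: "g \<in> f +o P_gt \<nu> \<alpha> \<longleftrightarrow> g - f \<in> P_gt \<nu> \<alpha>"
  unfolding elt_set_plus_def by (auto simp: algebra_simps intro: bexI[of _ "g - f"])

lemma coset_eq: "f +o P_gt \<nu> \<alpha> = g +o P_gt \<nu> \<alpha> \<longleftrightarrow> f - g \<in> P_gt \<nu> \<alpha>"
proof
  assume *: "f - g \<in> P_gt \<nu> \<alpha>"
  show "f +o P_gt \<nu> \<alpha> = g +o P_gt \<nu> \<alpha>"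
  proof (intro Set.set_eqI)
    fix h
    show "h \<in> f +o P_gt \<nu> \<alpha> \<longleftrightarrow> h \<in> g +o P_gt \<nu> \<alpha>"
      unfolding coset_mem
      using P_gt_add[of "h - f" \<alpha> "f - g"] P_gt_diff[of "h - g" \<alpha> "f - g"] * by auto
  qed
next
  assume "f +o P_gt \<nu> \<alpha> = g +o P_gt \<nu> \<alpha>"
  moreover have "f \<in> f +o P_gt \<nu> \<alpha>" by (simp add: coset_mem P_gt_0)
  ultimately show "f - g \<in> P_gt \<nu> \<alpha>" using coset_mem by blast
qed

lemma coset_eq_zero: "f +o P_gt \<nu> \<alpha> = P_gt \<nu> \<alpha> \<longleftrightarrow> f \<in> P_gt \<nu> \<alpha>"
  using coset_eq[of f \<alpha> 0] by (simp add: elt_set_plus_def)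

lemma coset_add: "(f +o P_gt \<nu> \<alpha>) + (g +o P_gt \<nu> \<alpha>) = (f + g) +o P_gt \<nu> \<alpha>"
proof (intro Set.set_eqI iffI)
  fix h assume "h \<in> (f +o P_gt \<nu> \<alpha>) + (g +o P_gt \<nu> \<alpha>)"
  then obtain a b where "h = a + b" "a - f \<in> P_gt \<nu> \<alpha>" "b - g \<in> P_gt \<nu> \<alpha>"
    unfolding set_plus_def by (auto simp: coset_mem)
  then show "h \<in> (f + g) +o P_gt \<nu> \<alpha>"
    using P_gt_add[of "a - f" \<alpha> "b - g"] by (simp add: coset_mem algebra_simps)
next
  fix h assume "h \<in> (f + g) +o P_gt \<nu> \<alpha>"
  then have "(h - g) \<in> f +o P_gt \<nu> \<alpha>" by (simp add: coset_mem algebra_simps)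
  moreover have "g \<in> g +o P_gt \<nu> \<alpha>" by (simp add: coset_mem P_gt_0)
  ultimately have "(h - g) + g \<in> (f +o P_gt \<nu> \<alpha>) + (g +o P_gt \<nu> \<alpha>)" by blast
  then show "h \<in> (f +o P_gt \<nu> \<alpha>) + (g +o P_gt \<nu> \<alpha>)" by simp
qed

lemma coset_mult_subset:
  assumes "f \<in> P_ge \<nu> \<alpha>" "g \<in> P_ge \<nu> \<beta>"
  shows "(f +o P_gt \<nu> \<alpha>) * (g +o P_gt \<nu> \<beta>) \<subseteq> (f * g) +o P_gt \<nu> (\<alpha> + \<beta>)"
proof
  fix h assume "h \<in> (f +o P_gt \<nu> \<alpha>) * (g +o P_gt \<nu> \<beta>)"
  then obtain a b where h: "h = a * b" "a - f \<in> P_gt \<nu> \<alpha>" "b - g \<in> P_gt \<nu> \<beta>"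
    unfolding set_times_def by (auto simp: coset_mem)
  have "b \<in> P_ge \<nu> \<beta>" using P_ge_add[of g \<beta> "b - g"] h P_gt_subset assms by auto
  then have "(a - f) * b \<in> P_gt \<nu> (\<alpha> + \<beta>)" "f * (b - g) \<in> P_gt \<nu> (\<alpha> + \<beta>)"
    using P_gt_ge_mult P_ge_gt_mult h assms by blast+
  from P_gt_add[OF this] show "h \<in> (f * g) +o P_gt \<nu> (\<alpha> + \<beta>)"
    by (simp add: coset_mem h algebra_simps)
qed

lemma sum_cosets:
  assumes "finite I" "\<And>i. i \<in> I \<Longrightarrow> A i \<noteq> {}" "\<And>i. i \<in> I \<Longrightarrow> A i \<subseteq> a i +o P_gt \<nu> \<alpha>"
  shows "sum A I + P_gt \<nu> \<alpha> = sum a I +o P_gt \<nu> \<alpha>"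
  using assms
proof (induction I)
  case empty
  then show ?case by (simp add: elt_set_plus_def)
next
  case (insert i I)
  have IH: "sum A I + P_gt \<nu> \<alpha> = sum a I +o P_gt \<nu> \<alpha>" using insert by auto
  obtain c where c: "c \<in> A i" using insert.prems(1)[of i] by blast
  have "A i + (sum a I +o P_gt \<nu> \<alpha>) = (a i + sum a I) +o P_gt \<nu> \<alpha>"
  proof
    have "A i + (sum a I +o P_gt \<nu> \<alpha>) \<subseteq> (a i +o P_gt \<nu> \<alpha>) + (sum a I +o P_gt \<nu> \<alpha>)"
      using insert.prems by (intro set_plus_mono2) auto
    then show "A i + (sum a I +o P_gt \<nu> \<alpha>) \<subseteq> (a i + sum a I) +o P_gt \<nu> \<alpha>"
      by (simp add: coset_add)
    show "(a i + sum a I) +o P_gt \<nu> \<alpha> \<subseteq> A i + (sum a I +o P_gt \<nu> \<alpha>)"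
    proof
      fix h assume "h \<in> (a i + sum a I) +o P_gt \<nu> \<alpha>"
      moreover have "c - a i \<in> P_gt \<nu> \<alpha>" using c insert.prems coset_mem by blast
      ultimately have "h - c \<in> sum a I +o P_gt \<nu> \<alpha>"
        using P_gt_diff[of "h - (a i + sum a I)" \<alpha> "c - a i"] by (simp add: coset_mem algebra_simps)
      with c have "c + (h - c) \<in> A i + (sum a I +o P_gt \<nu> \<alpha>)" by blast
      then show "h \<in> A i + (sum a I +o P_gt \<nu> \<alpha>)" by simp
    qed
  qed
  then show ?case using insert.hyps IH by (simp add: add.assoc)
qed

lemma sum_P_gt: "(\<And>i. i \<in> I \<Longrightarrow> a i \<in> P_gt \<nu> \<alpha>) \<Longrightarrow> sum a I \<in> P_gt \<nu> \<alpha>"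
  by (induction I rule: infinite_finite_induct) (auto simp: P_gt_0 P_gt_add)

text \<open>
  To see that the graded algebra is a commutative ring, present it as the image of the ring of
  finitely supported families of representatives.
\<close>

abbreviation (input) lookup where "lookup \<equiv> Poly_Mapping.lookup"
abbreviation (input) keys where "keys \<equiv> Poly_Mapping.keys"

definition rep_ring :: "('g \<Rightarrow>\<^sub>0 'k poly) ring" where
  "rep_ring = \<lparr> carrier = {F. \<forall>\<alpha>. lookup F \<alpha> \<in> P_ge \<nu> \<alpha>}, mult = (*), one = 1, zero = 0, add = (+) \<rparr>"

definition rep_hom :: "('g \<Rightarrow>\<^sub>0 'k poly) \<Rightarrow> 'g \<Rightarrow> 'k poly set" where
  "rep_hom F = (\<lambda>\<alpha>. lookup F \<alpha> +o P_gt \<nu> \<alpha>)"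

lemma lookup_times_eq:
  fixes F G :: "'g \<Rightarrow>\<^sub>0 'k poly"
  shows "lookup (F * G) \<gamma> = (\<Sum>\<alpha>\<in>keys F. lookup F \<alpha> * lookup G (\<gamma> - \<alpha>))"
proof -
  have "(\<Sum>q. lookup G q when \<gamma> = l + q) = lookup G (\<gamma> - l)" for l
  proof -
    have "(\<lambda>q. lookup G q when \<gamma> = l + q) = (\<lambda>q. lookup G q when q = \<gamma> - l)"
      by (auto simp: fun_eq_iff when_def algebra_simps)
    then show ?thesis by (simp only: Sum_any_when_equal)
  qed
  then have "lookup (F * G) \<gamma> = (\<Sum>l. lookup F l * lookup G (\<gamma> - l))"
    by (simp add: times_poly_mapping.rep_eq prod_fun_def)
  also have "\<dots> = (\<Sum>\<alpha>\<in>keys F. lookup F \<alpha> * lookup G (\<gamma> - \<alpha>))"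
    by (rule Sum_any.expand_superset) (auto simp: in_keys_iff)
  finally show ?thesis .
qed

lemma P_ge_sum: "(\<And>i. i \<in> I \<Longrightarrow> a i \<in> P_ge \<nu> \<alpha>) \<Longrightarrow> sum a I \<in> P_ge \<nu> \<alpha>"
  using P_gt_0 P_gt_subset by (induction I rule: infinite_finite_induct) (auto simp: P_ge_add)

lemma rep_ring_cring: "cring rep_ring"
proof (rule cringI)
  show "abelian_group rep_ring"
  proof (rule abelian_groupI)
    fix F assume "F \<in> carrier rep_ring"
    then have "- F \<in> carrier rep_ring" "- F \<oplus>\<^bsub>rep_ring\<^esub> F = \<zero>\<^bsub>rep_ring\<^esub>"
      by (auto simp: rep_ring_def P_ge_uminus)
    then show "\<exists>G \<in> carrier rep_ring. G \<oplus>\<^bsub>rep_ring\<^esub> F = \<zero>\<^bsub>rep_ring\<^esub>" by blast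
  qed (auto simp: rep_ring_def lookup_add P_ge_add add.assoc add.commute
        intro: subsetD[OF P_gt_subset P_gt_0])
  show "comm_monoid rep_ring"
  proof (rule comm_monoidI)
    fix F G assume FG: "F \<in> carrier rep_ring" "G \<in> carrier rep_ring"
    have "lookup F \<alpha> * lookup G (\<gamma> - \<alpha>) \<in> P_ge \<nu> \<gamma>" for \<alpha> \<gamma>
      using FG P_ge_mult[of "lookup F \<alpha>" \<alpha> "lookup G (\<gamma> - \<alpha>)" "\<gamma> - \<alpha>"] by (simp add: rep_ring_def)
    then show "F \<otimes>\<^bsub>rep_ring\<^esub> G \<in> carrier rep_ring"
      by (auto simp: rep_ring_def lookup_times_eq intro: P_ge_sum)
  next
    have "1 \<in> P_ge \<nu> 0" by (simp add: P_ge_def valuation_1[OF v] zero_with_infty_def)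
    then show "\<one>\<^bsub>rep_ring\<^esub> \<in> carrier rep_ring"
      using P_gt_0 P_gt_subset by (auto simp: rep_ring_def lookup_one when_def)
  qed (auto simp: rep_ring_def mult.assoc mult.commute)
qed (auto simp: rep_ring_def distrib_right)

lemma rep_hom_supp: "gr_supp \<nu> (rep_hom F) \<subseteq> keys F"
  by (auto simp: gr_supp_def rep_hom_def coset_eq_zero in_keys_iff P_gt_0)

lemma rep_hom_image: "rep_hom ` carrier rep_ring = carrier (graded_algebra \<nu>)"
proof (intro Set.set_eqI iffI)
  fix G assume "G \<in> rep_hom ` carrier rep_ring"
  then obtain F where F: "F \<in> carrier rep_ring" "G = rep_hom F" by auto
  have "finite (gr_supp \<nu> G)" using finite_subset[OF rep_hom_supp[of F]] F by simp
  then show "G \<in> carrier (graded_algebra \<nu>)"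
    using F by (auto simp: graded_algebra_def rep_ring_def rep_hom_def)
next
  fix G assume G: "G \<in> carrier (graded_algebra \<nu>)"
  then have fin: "finite (gr_supp \<nu> G)" 
    and "\<forall>\<alpha>. \<exists>f \<in> P_ge \<nu> \<alpha>. G \<alpha> = f +o P_gt \<nu> \<alpha>" by (auto simp: graded_algebra_def)
  then obtain r where r: "\<And>\<alpha>. r \<alpha> \<in> P_ge \<nu> \<alpha>" "\<And>\<alpha>. G \<alpha> = r \<alpha> +o P_gt \<nu> \<alpha>" by metis
  define s where "s = (\<lambda>\<alpha>. if \<alpha> \<in> gr_supp \<nu> G then r \<alpha> else 0)"
  have "finite {\<alpha>. s \<alpha> \<noteq> 0}" by (rule finite_subset[OF _ fin]) (auto simp: s_def)
  then obtain F where l: "lookup F = s" by (metis lookup_Abs_poly_mapping)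
  have "s \<alpha> \<in> P_ge \<nu> \<alpha>" for \<alpha> using r(1) P_gt_0 P_gt_subset by (auto simp: s_def)
  then have "F \<in> carrier rep_ring" by (simp add: rep_ring_def l)
  moreover have "s \<alpha> +o P_gt \<nu> \<alpha> = G \<alpha>" for \<alpha>
    using r(2)[of \<alpha>] by (auto simp: s_def gr_supp_def elt_set_plus_def)
  then have "rep_hom F = G" by (simp add: rep_hom_def l)
  ultimately show "G \<in> rep_hom ` carrier rep_ring" by blast
qed

lemma rep_hom_mult:
  assumes "F \<in> carrier rep_ring" "G \<in> carrier rep_ring"
  shows "rep_hom (F * G) = rep_hom F \<otimes>\<^bsub>graded_algebra \<nu>\<^esub> rep_hom G"
proof
  fix \<gamma>
  let ?S = "gr_supp \<nu> (rep_hom F)" and ?p = "\<lambda>\<alpha>. lookup F \<alpha> * lookup G (\<gamma> - \<alpha>)"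
  have FG: "lookup F \<alpha> \<in> P_ge \<nu> \<alpha>" "lookup G \<alpha> \<in> P_ge \<nu> \<alpha>" for \<alpha>
    using assms by (auto simp: rep_ring_def)
  have fin: "finite ?S" using finite_subset[OF rep_hom_supp[of F]] by simp
  have sub: "rep_hom F \<alpha> * rep_hom G (\<gamma> - \<alpha>) \<subseteq> ?p \<alpha> +o P_gt \<nu> \<gamma>" for \<alpha>
    using coset_mult_subset[OF FG(1)[of \<alpha>] FG(2)[of "\<gamma> - \<alpha>"]] by (simp add: rep_hom_def)
  have ne: "rep_hom F \<alpha> * rep_hom G (\<gamma> - \<alpha>) \<noteq> {}" for \<alpha>
    using P_gt_0 unfolding rep_hom_def set_times_def elt_set_plus_def by blast
  have "(rep_hom F \<otimes>\<^bsub>graded_algebra \<nu>\<^esub> rep_hom G) \<gamma> = (\<Sum>\<alpha>\<in>?S. ?p \<alpha>) +o P_gt \<nu> \<gamma>"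
    using sum_cosets[of ?S "\<lambda>\<alpha>. rep_hom F \<alpha> * rep_hom G (\<gamma> - \<alpha>)" ?p \<gamma>] fin sub ne
    by (simp add: graded_algebra_def)
  also have "\<dots> = lookup (F * G) \<gamma> +o P_gt \<nu> \<gamma>"
  proof -
    have "lookup (F * G) \<gamma> - (\<Sum>\<alpha>\<in>?S. ?p \<alpha>) = (\<Sum>\<alpha>\<in>keys F - ?S. ?p \<alpha>)"
      unfolding lookup_times_eq using rep_hom_supp[of F] by (simp add: sum_diff)
    also have "\<dots> \<in> P_gt \<nu> \<gamma>"
    proof (rule sum_P_gt)
      fix \<alpha> assume "\<alpha> \<in> keys F - ?S"
      then have "lookup F \<alpha> \<in> P_gt \<nu> \<alpha>"
        by (simp add: gr_supp_def rep_hom_def coset_eq_zero)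
      from P_gt_ge_mult[OF this FG(2)[of "\<gamma> - \<alpha>"]] show "?p \<alpha> \<in> P_gt \<nu> \<gamma>" by simp
    qed
    finally show ?thesis using coset_eq by metis
  qed
  finally show "rep_hom (F * G) \<gamma> = (rep_hom F \<otimes>\<^bsub>graded_algebra \<nu>\<^esub> rep_hom G) \<gamma>"
    by (simp add: rep_hom_def)
qed

lemma rep_hom_ring_hom: "rep_hom \<in> ring_hom rep_ring (graded_algebra \<nu>)"
proof (rule ring_hom_memI)
  show "rep_hom F \<in> carrier (graded_algebra \<nu>)" if "F \<in> carrier rep_ring" for F
    using that rep_hom_image by blast
  show "rep_hom (F \<otimes>\<^bsub>rep_ring\<^esub> G) = rep_hom F \<otimes>\<^bsub>graded_algebra \<nu>\<^esub> rep_hom G"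
    if "F \<in> carrier rep_ring" "G \<in> carrier rep_ring" for F G
    using rep_hom_mult[OF that] by (simp add: rep_ring_def)
  show "rep_hom (F \<oplus>\<^bsub>rep_ring\<^esub> G) = rep_hom F \<oplus>\<^bsub>graded_algebra \<nu>\<^esub> rep_hom G" for F G
    by (simp add: rep_ring_def rep_hom_def graded_algebra_def lookup_add coset_add)
  show "rep_hom \<one>\<^bsub>rep_ring\<^esub> = \<one>\<^bsub>graded_algebra \<nu>\<^esub>"
    by (auto simp: rep_ring_def rep_hom_def graded_algebra_def lookup_one when_def fun_eq_iff
        elt_set_plus_def)
qed

lemma graded_algebra_cring: "cring (graded_algebra \<nu>)"
proof -
  interpret R: cring rep_ring by (rule rep_ring_cring)
  have z: "rep_hom \<zero>\<^bsub>rep_ring\<^esub> = \<zero>\<^bsub>graded_algebra \<nu>\<^esub>"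
    by (simp add: rep_ring_def rep_hom_def graded_algebra_def elt_set_plus_def)
  have "ring ((graded_algebra \<nu>) \<lparr> carrier := rep_hom ` carrier rep_ring,
                                  zero := rep_hom \<zero>\<^bsub>rep_ring\<^esub> \<rparr>)"
    by (rule R.ring_hom_imp_img_ring[OF rep_hom_ring_hom])
  then have ring: "ring (graded_algebra \<nu>)" unfolding rep_hom_image z by simp
  have comm: "x \<otimes>\<^bsub>graded_algebra \<nu>\<^esub> y = y \<otimes>\<^bsub>graded_algebra \<nu>\<^esub> x"
    if "x \<in> carrier (graded_algebra \<nu>)" "y \<in> carrier (graded_algebra \<nu>)" for x y
  proof -
    from that obtain F G where
      "F \<in> carrier rep_ring" "x = rep_hom F" "G \<in> carrier rep_ring" "y = rep_hom G"
      unfolding rep_hom_image[symmetric] by blast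
    then show ?thesis by (metis rep_hom_mult mult.commute)
  qed
  interpret G: ring "graded_algebra \<nu>" by (rule ring)
  show ?thesis by unfold_locales (rule comm)
qed

lemma initial_closed: "initial \<nu> g \<in> carrier (graded_algebra \<nu>)"
proof -
  have "gr_supp \<nu> (initial \<nu> g) \<subseteq> {the_fin (\<nu> g)}"
    by (auto simp: gr_supp_def initial_def split: if_splits)
  then have "finite (gr_supp \<nu> (initial \<nu> g))" using finite_subset by blast
  moreover have "\<exists>f \<in> P_ge \<nu> \<alpha>. initial \<nu> g \<alpha> = f +o P_gt \<nu> \<alpha>" for \<alpha>
  proof (cases "\<nu> g = Fin \<alpha>")
    case True
    then show ?thesis by (auto simp: initial_def P_ge_def intro!: exI[of _ g])
  next
    case False
    then have "initial \<nu> g \<alpha> = 0 +o P_gt \<nu> \<alpha>" by (simp add: initial_def elt_set_plus_def)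
    then show ?thesis using P_gt_0 P_gt_subset by blast
  qed
  ultimately show ?thesis by (simp add: graded_algebra_def)
qed

end


section \<open>MacLane--Vaquie key polynomials\<close>

definition val_dvd ::
    "('k :: field poly \<Rightarrow> 'g :: linordered_ab_group_add with_infty) \<Rightarrow>
     'k poly \<Rightarrow> 'k poly \<Rightarrow> bool" where
  "val_dvd \<nu> h g \<longleftrightarrow> initial \<nu> h divides\<^bsub>graded_algebra \<nu>\<^esub> initial \<nu> g"

definition KP ::
    "('k :: field poly \<Rightarrow> 'g :: linordered_ab_group_add with_infty) \<Rightarrow> 'k poly set" where
  "KP \<nu> = {g. lead_coeff g = 1 \<and>
     primeideal (PIdl\<^bsub>graded_algebra \<nu>\<^esub> (initial \<nu> g)) (graded_algebra \<nu>) \<and>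
     PIdl\<^bsub>graded_algebra \<nu>\<^esub> (initial \<nu> g) \<noteq> {\<zero>\<^bsub>graded_algebra \<nu>\<^esub>} \<and>
     (\<forall>f. f \<noteq> 0 \<and> degree f < degree g \<longrightarrow> \<not> val_dvd \<nu> g f)}"


section \<open>Expansions and augmentations\<close>

text \<open>
  \<open>adic_coeff Q f s\<close> is the coefficient of \<open>Q ^ s\<close> in the \<open>Q\<close>-expansion of \<open>f\<close>, for non-constant
  \<open>Q\<close>; it vanishes for \<open>s > degree f\<close>, and the lemmas below characterise the expansion.
\<close>

definition adic_coeff :: "'k :: field poly \<Rightarrow> 'k poly \<Rightarrow> nat \<Rightarrow> 'k poly" where
  "adic_coeff Q f s = (f div Q ^ s) mod Q"

lemma degree_adic_coeff: "degree Q > 0 \<Longrightarrow> degree (adic_coeff Q f s) < degree Q"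
  unfolding adic_coeff_def using degree_mod_less[of Q "f div Q ^ s"] by fastforce

lemma adic_expansion_aux:
  fixes Q f :: "'k :: field poly"
  assumes "degree Q > 0"
  shows "f = (\<Sum>s<n. adic_coeff Q f s * Q ^ s) + (f div Q ^ n) * Q ^ n"
proof (induction n)
  case (Suc n)
  have "f div Q ^ n = (f div Q ^ n) div Q * Q + adic_coeff Q f n"
    by (simp add: adic_coeff_def)
  moreover have "(f div Q ^ n) div Q = f div Q ^ Suc n"
    by (metis poly_div_mult_right mult.commute power_Suc)
  ultimately have "(f div Q ^ n) * Q ^ n = adic_coeff Q f n * Q ^ n + (f div Q ^ Suc n) * Q ^ Suc n"
    by (metis (no_types, lifting) add.commute distrib_right mult.assoc power_Suc)
  then show ?case using Suc by (simp add: add.assoc)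
qed simp

lemma adic_coeff_beyond:
  fixes Q f :: "'k :: field poly"
  assumes "degree Q > 0" "s > degree f"
  shows "f div Q ^ s = 0" "adic_coeff Q f s = 0"
proof -
  have "Q \<noteq> 0" using assms by auto
  then have "degree (Q ^ s) = s * degree Q" by (simp add: degree_power_eq)
  moreover have "s * 1 \<le> s * degree Q" using assms by (intro mult_le_mono2) simp
  ultimately have "degree f < degree (Q ^ s)" using assms by linarith
  then show "f div Q ^ s = 0" by (simp add: div_poly_less)
  then show "adic_coeff Q f s = 0" by (simp add: adic_coeff_def)
qed

lemma adic_expansion:
  fixes Q f :: "'k :: field poly"
  assumes "degree Q > 0"
  shows "f = (\<Sum>s\<le>degree f. adic_coeff Q f s * Q ^ s)"
  using adic_expansion_aux[OF assms, of f "Suc (degree f)"]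
    adic_coeff_beyond(1)[OF assms, of f "Suc (degree f)"]
  by (simp add: lessThan_Suc_atMost)

lemma adic_expansion_unique:
  fixes Q :: "'k :: field poly"
  assumes "\<And>s. degree (a s) < degree Q"
  shows "adic_coeff Q (\<Sum>s<n. a s * Q ^ s) t = (if t < n then a t else 0)"
  using assms
proof (induction n arbitrary: a t)
  case 0
  then show ?case by (simp add: adic_coeff_def)
next
  case (Suc n)
  let ?g = "\<Sum>s<n. a (Suc s) * Q ^ s"
  have Q: "Q \<noteq> 0" using Suc.prems[of 0] by auto
  have eq: "(\<Sum>s<Suc n. a s * Q ^ s) = a 0 + Q * ?g"
    by (subst sum.lessThan_Suc_shift) (simp add: sum_distrib_left mult_ac)
  have m: "(a 0 + Q * ?g) mod Q = a 0" using Suc.prems[of 0] by (simp add: mod_poly_less)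
  have d: "(a 0 + Q * ?g) div Q = ?g" using Suc.prems[of 0] Q by (simp add: div_poly_less)
  show ?case
  proof (cases t)
    case 0
    then show ?thesis unfolding eq using m by (simp add: adic_coeff_def)
  next
    case (Suc u)
    have "(a 0 + Q * ?g) div Q ^ Suc u = ?g div Q ^ u"
      using poly_div_mult_right[of "a 0 + Q * ?g" Q "Q ^ u"] d by simp
    then show ?thesis unfolding eq using Suc Suc.IH[of "\<lambda>s. a (Suc s)" u] Suc.prems
      by (simp add: adic_coeff_def)
  qed
qed

definition augmentation ::
    "('k :: field poly \<Rightarrow> 'g :: linordered_ab_group_add with_infty) \<Rightarrow> 'k poly \<Rightarrow> 'g \<Rightarrow>
     'k poly \<Rightarrow> 'g with_infty" where
  "augmentation \<rho> \<chi> \<beta> f =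
     Min ((\<lambda>s. \<rho> (adic_coeff \<chi> f s) + Fin (nsmul s \<beta>)) ` {..degree f})"

definition truncation ::
    "('k :: field poly \<Rightarrow> 'g :: linordered_ab_group_add with_infty) \<Rightarrow> 'k poly \<Rightarrow>
     'k poly \<Rightarrow> 'g with_infty" where
  "truncation \<nu> Q f = Min ((\<lambda>s. \<nu> (adic_coeff Q f s * Q ^ s)) ` {..degree f})"


section \<open>Continuous MacLane chains\<close>

text \<open>\<open>\<chi> 0\<close> and \<open>\<beta> 0\<close> are not used.\<close>

definition continuous_MacLane_chain ::
    "(nat \<Rightarrow> 'k :: field poly \<Rightarrow> 'g :: linordered_ab_group_add with_infty) \<Rightarrow>
     (nat \<Rightarrow> 'k poly) \<Rightarrow> (nat \<Rightarrow> 'g) \<Rightarrow> nat \<Rightarrow> bool" where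
  "continuous_MacLane_chain \<rho> \<chi> \<beta> m \<longleftrightarrow>
     (\<forall>i. valuation (\<rho> i)) \<and>
     KP (\<rho> 0) \<noteq> {} \<and>
     (\<forall>i\<ge>1. \<chi> i \<in> KP (\<rho> (i - 1)) \<and>
            Fin (\<beta> i) > \<rho> (i - 1) (\<chi> i) \<and>
            \<rho> i = augmentation (\<rho> (i - 1)) (\<chi> i) (\<beta> i) \<and>
            degree (\<chi> i) = m \<and>
            \<not> val_dvd (\<rho> i) (\<chi> (i + 1)) (\<chi> i))"

definition stable ::
    "(nat \<Rightarrow> 'k :: field poly \<Rightarrow> 'g :: linordered_ab_group_add with_infty) \<Rightarrow> 'k poly \<Rightarrow> bool" where
  "stable \<rho> f \<longleftrightarrow> (\<exists>N. \<forall>i\<ge>N. \<rho> i f = \<rho> N f)"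

definition m_infty ::
    "(nat \<Rightarrow> 'k :: field poly \<Rightarrow> 'g :: linordered_ab_group_add with_infty) \<Rightarrow> enat" where
  "m_infty \<rho> = (INF f \<in> {f. \<not> stable \<rho> f}. enat (degree f))"

definition essential_chain ::
    "(nat \<Rightarrow> 'k :: field poly \<Rightarrow> 'g :: linordered_ab_group_add with_infty) \<Rightarrow>
     (nat \<Rightarrow> 'k poly) \<Rightarrow> (nat \<Rightarrow> 'g) \<Rightarrow> nat \<Rightarrow> bool" where
  "essential_chain \<rho> \<chi> \<beta> m \<longleftrightarrow>
     continuous_MacLane_chain \<rho> \<chi> \<beta> m \<and> enat m < m_infty \<rho> \<and> m_infty \<rho> < \<infinity>"

definition MLV_limit_key_polynomials ::
    "(nat \<Rightarrow> 'k :: field poly \<Rightarrow> 'g :: linordered_ab_group_add with_infty) \<Rightarrow> 'k poly set" where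
  "MLV_limit_key_polynomials \<rho> =
     {Q. lead_coeff Q = 1 \<and> \<not> stable \<rho> Q \<and> enat (degree Q) = m_infty \<rho>}"


section \<open>Abstract key polynomials and limit key polynomials\<close>

text \<open>
  \<open>f(x + y)\<close> is formed in the ring of polynomials in \<open>y\<close> with coefficients in the polynomials
  in \<open>x\<close>, where \<open>x + y\<close> is \<open>[:[:0, 1:], 1:]\<close>.
\<close>

definition hasse_deriv :: "nat \<Rightarrow> 'k :: field poly \<Rightarrow> 'k poly" where
  "hasse_deriv b f = coeff (pcompose (map_poly (\<lambda>c. [:c:]) f) [:[:0, 1:], 1:]) b"

text \<open>
  Terms with \<open>\<nu> (hasse_deriv b f) = Infty\<close> have value minus infinity in the maximum that
  defines \<open>epsilon \<nu> f\<close> and are left out; for non-constant \<open>f\<close> the term for \<open>b = degree f\<close>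
  always remains (\<open>epsilon_set_finite\<close>, \<open>epsilon_set_nonempty\<close>).
\<close>

definition epsilon_set ::
    "('k :: field poly \<Rightarrow> 'g :: linordered_ab_group_add with_infty) \<Rightarrow> 'k poly \<Rightarrow> 'g div_hull set" where
  "epsilon_set \<nu> f = {hull_frac (the_fin (\<nu> f) - the_fin (\<nu> (hasse_deriv b f))) b | b.
     b \<ge> 1 \<and> \<nu> (hasse_deriv b f) \<noteq> Infty}"

definition epsilon ::
    "('k :: field poly \<Rightarrow> 'g :: linordered_ab_group_add with_infty) \<Rightarrow> 'k poly \<Rightarrow>
     'g div_hull with_infty" where
  "epsilon \<nu> f = (if \<nu> f = Infty then Infty else Fin (Max (epsilon_set \<nu> f)))"

lemma shift_poly_degree:
  fixes f :: "'k :: field poly"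
  defines "F \<equiv> pcompose (map_poly (\<lambda>c. [:c:]) f) [:[:0, 1:], 1:]"
  shows "degree F = degree f" "lead_coeff F = [:lead_coeff f:]"
proof -
  have 1: "degree (map_poly (\<lambda>c. [:c:]) f) = degree f" by (rule degree_map_poly) simp
  show "degree F = degree f" unfolding F_def using 1 by (simp add: degree_pcompose)
  show "lead_coeff F = [:lead_coeff f:]"
    unfolding F_def using 1 by (simp add: lead_coeff_comp coeff_map_poly)
qed

lemma hasse_deriv_degree: "hasse_deriv (degree f) f = [:lead_coeff f:]"
  using shift_poly_degree[of f] by (simp add: hasse_deriv_def)

lemma hasse_deriv_beyond: "b > degree f \<Longrightarrow> hasse_deriv b f = 0"
  using shift_poly_degree(1)[of f] by (simp add: hasse_deriv_def coeff_eq_0)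

lemma epsilon_set_finite: "valuation \<nu> \<Longrightarrow> finite (epsilon_set \<nu> f)"
proof -
  assume "valuation \<nu>"
  then have "\<nu> (hasse_deriv b f) \<noteq> Infty \<Longrightarrow> b \<le> degree f" for b
    using hasse_deriv_beyond[of f b] valuation_0 by (metis linorder_not_less)
  then have "epsilon_set \<nu> f \<subseteq>
      (\<lambda>b. hull_frac (the_fin (\<nu> f) - the_fin (\<nu> (hasse_deriv b f))) b) ` {..degree f}"
    by (auto simp: epsilon_set_def)
  then show ?thesis using finite_subset by blast
qed

lemma epsilon_set_nonempty: "valuation \<nu> \<Longrightarrow> degree f > 0 \<Longrightarrow> epsilon_set \<nu> f \<noteq> {}"
proof -
  assume "valuation \<nu>" and f: "degree f > 0"
  then have "\<nu> (hasse_deriv (degree f) f) \<noteq> Infty"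
    unfolding hasse_deriv_degree valuation_def field_valuation_def by auto
  moreover have "degree f \<ge> 1" using f by simp
  ultimately show ?thesis unfolding epsilon_set_def by blast
qed

definition abstract_key_polynomial ::
    "('k :: field poly \<Rightarrow> 'g :: linordered_ab_group_add with_infty) \<Rightarrow> 'k poly \<Rightarrow> bool" where
  "abstract_key_polynomial \<nu> Q \<longleftrightarrow>
     lead_coeff Q = 1 \<and> degree Q > 0 \<and>
     (\<forall>f. 0 < degree f \<and> degree f < degree Q \<longrightarrow> epsilon \<nu> f < epsilon \<nu> Q)"

definition Phi ::
    "('k :: field poly \<Rightarrow> 'g :: linordered_ab_group_add with_infty) \<Rightarrow>
     ('k poly \<Rightarrow> 'g with_infty) \<Rightarrow> 'k poly set" where
  "Phi \<mu> \<nu> = {\<phi>. lead_coeff \<phi> = 1 \<and> \<mu> \<phi> < \<nu> \<phi> \<and>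
     (\<forall>g. lead_coeff g = 1 \<and> \<mu> g < \<nu> g \<longrightarrow> degree \<phi> \<le> degree g)}"

definition deg_Phi ::
    "('k :: field poly \<Rightarrow> 'g :: linordered_ab_group_add with_infty) \<Rightarrow>
     ('k poly \<Rightarrow> 'g with_infty) \<Rightarrow> nat" where
  "deg_Phi \<mu> \<nu> = (LEAST n. \<exists>\<phi>. lead_coeff \<phi> = 1 \<and> \<mu> \<phi> < \<nu> \<phi> \<and> degree \<phi> = n)"

definition abstract_limit_key_polynomial ::
    "('k :: field poly \<Rightarrow> 'g :: linordered_ab_group_add with_infty) \<Rightarrow> 'k poly \<Rightarrow> bool" where
  "abstract_limit_key_polynomial \<nu> Q \<longleftrightarrow>
     lead_coeff Q = 1 \<and>
     (\<exists>Q'. abstract_key_polynomial \<nu> Q' \<and> val_less (truncation \<nu> Q') \<nu> \<and>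
        (let \<Phi> = Phi (truncation \<nu> Q') \<nu>;
             K3 = (\<lambda>f. \<forall>\<chi>\<in>\<Phi>. truncation \<nu> \<chi> f < \<nu> f)
         in degree Q' = deg_Phi (truncation \<nu> Q') \<nu> \<and>
            \<not> (\<exists>\<alpha> \<in> \<nu> ` \<Phi>. \<forall>\<beta> \<in> \<nu> ` \<Phi>. \<beta> \<le> \<alpha>) \<and>
            K3 Q \<and>
            (\<forall>f. K3 f \<longrightarrow> degree Q \<le> degree f)))"

end

theory Submission
  imports Defs
begin

text \<open>
  In degrees below \<open>m\<close> all \<open>\<rho> i\<close> agree with \<open>\<nu>\<close>: an MLV key polynomial \<open>\<chi>\<close> for
  \<open>\<mu>\<close> whose value grows from \<open>\<mu>\<close> to \<open>\<nu>\<close> forces \<open>\<mu> = \<nu>\<close> in degrees below \<open>degree \<chi>\<close>, since a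
  polynomial of least degree whose value grows would divide \<open>\<chi>\<close> up to terms of larger value, and
  both factors would be too short to be divisible by \<open>in \<chi>\<close> (\<open>KP_small_agree\<close>). The
  incomparability condition in the chain then says exactly that \<open>\<chi> (i + 1) - \<chi> i\<close> has value
  \<open>\<beta> i\<close>, so that \<open>\<beta>\<close> is strictly increasing and \<open>\<nu> (\<chi> i) = \<beta> i\<close>. Hence \<open>\<rho> i\<close> is the truncation
  of \<open>\<nu>\<close> at \<open>\<chi> i\<close> (\<open>chain_eq_truncation\<close>), and the sequence increases.

  Stability means reaching \<open>\<nu>\<close>: if \<open>f\<close> has the same value at two consecutive steps,
  then in the expansion of \<open>f\<close> along the next \<open>\<chi>\<close> the constant term alone carries that value, and
  it still does for \<open>\<nu>\<close> (\<open>stable_iff_attains\<close>). So a polynomial is non-stable if and only if all the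
  truncations stay strictly below \<open>\<nu>\<close> on it.

  The witness for \<open>Q\<^sub>-\<close> is \<open>\<chi> 1\<close>. That it is an abstract key polynomial is the one point where
  the Hasse derivatives enter (\<open>abstract_key_polynomialI\<close>): the invariant \<open>\<epsilon> f\<close> is the least
  \<open>\<epsilon>\<close> for which the Gauss extension of \<open>\<nu>\<close> giving \<open>y\<close> the value \<open>\<epsilon>\<close> takes the value
  \<open>\<nu> f\<close> at \<open>f(x + y)\<close>. If a shorter \<open>f\<close>, of least degree, had \<open>\<epsilon> f \<ge> \<epsilon> Q\<close>, the terms of the
  \<open>f\<close>-expansion of \<open>Q\<close> could not cancel in that extension, because their initial forms have different
  degrees in \<open>y\<close>; so all these terms have value at least \<open>\<nu> Q\<close>, and the smaller valuation, which
  agrees with \<open>\<nu>\<close> on them, could not be smaller at \<open>Q\<close>.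

  The set \<open>\<Phi>\<close> attached to \<open>\<chi> 1\<close> consists of monic polynomials of degree \<open>m\<close> and contains all later
  \<open>\<chi> i\<close>. Its members are stable, so their values, and the truncations at them, are
  dominated by those of some \<open>\<chi> i\<close>. So the values of \<open>\<nu>\<close> on \<open>\<Phi>\<close> have no maximum because \<open>\<beta>\<close> has none,
  and the polynomials at which every truncation along \<open>\<Phi>\<close> stays below \<open>\<nu>\<close> are exactly the non-stable
  ones, of which \<open>Q\<close> has least degree.
\<close>

section \<open>Values of sums and products\<close>

lemma nsmul_Fin: "nsmul n (Fin x) = Fin (nsmul n x)"
  by (induction n) (auto simp: zero_with_infty_def)

lemma nsmul_Infty: "n > 0 \<Longrightarrow> nsmul n Infty = Infty"
  by (cases n) auto

lemma nsmul_distrib: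
  fixes x y :: "'a :: comm_monoid_add"
  shows "nsmul n (x + y) = nsmul n x + nsmul n y"
  by (induction n) (simp_all add: ac_simps)

lemma nsmul_with_infty_mono:
  fixes x y :: "'g :: linordered_ab_group_add with_infty"
  shows "x \<le> y \<Longrightarrow> nsmul n x \<le> nsmul n y"
  by (induction n) (auto intro: add_mono)

context
  fixes \<nu> :: "'k :: field poly \<Rightarrow> 'g :: linordered_ab_group_add with_infty"
  assumes v: "valuation \<nu>"
begin

lemma val_diff: "min (\<nu> f) (\<nu> g) \<le> \<nu> (f - g)"
  using val_add[OF v, of f "- g"] valuation_minus[OF v, of g] by simp

lemma val_diff_commute: "\<nu> (f - g) = \<nu> (g - f)"
  using valuation_minus[OF v, of "f - g"] by simp

lemma val_sum_ge: "(\<And>i. i \<in> I \<Longrightarrow> c \<le> \<nu> (f i)) \<Longrightarrow> c \<le> \<nu> (sum f I)"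
proof (induction I rule: infinite_finite_induct)
  case (insert i I)
  then have "c \<le> min (\<nu> (f i)) (\<nu> (sum f I))" by simp
  also have "\<dots> \<le> \<nu> (f i + sum f I)" by (rule val_add[OF v])
  finally show ?case using insert by simp
qed (simp_all add: valuation_0[OF v])

lemma val_sum_gt: "(\<And>i. i \<in> I \<Longrightarrow> Fin c < \<nu> (f i)) \<Longrightarrow> Fin c < \<nu> (sum f I)"
  using sum_P_gt[OF v, of I f c] by (simp add: P_gt_def)

lemma val_add_eq:
  assumes "\<nu> f < \<nu> g"
  shows "\<nu> (f + g) = \<nu> f"
proof (rule antisym)
  show "\<nu> f \<le> \<nu> (f + g)" using val_add[OF v, of f g] assms by (simp add: min_absorb1)
  have "min (\<nu> (f + g)) (\<nu> g) \<le> \<nu> f" using val_diff[of "f + g" g] by simp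
  then show "\<nu> (f + g) \<le> \<nu> f" using assms by (auto simp: min_def split: if_splits)
qed

lemma val_power: "\<nu> (f ^ n) = nsmul n (\<nu> f)"
  by (induction n) (auto simp: valuation_1[OF v] val_mult[OF v])

lemma val_const_Infty_iff: "\<nu> [:a:] = Infty \<longleftrightarrow> a = 0"
  using v unfolding valuation_def field_valuation_def by blast

end


section \<open>Key polynomials of MacLane and Vaquie\<close>

context
  fixes \<nu> :: "'k :: field poly \<Rightarrow> 'g :: linordered_ab_group_add with_infty"
  assumes v: "valuation \<nu>"
begin

interpretation R: cring "graded_algebra \<nu>"
  by (rule graded_algebra_cring[OF v])

text \<open>
  Reads initial forms as images of homogeneous representatives, so that the product of the graded
  algebra can be computed on representatives.
\<close>
lemma initial_conv_rep_hom:
  assumes "\<nu> g = Fin \<alpha>"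
  shows "initial \<nu> g = rep_hom \<nu> (Poly_Mapping.single \<alpha> g)"
    and "Poly_Mapping.single \<alpha> g \<in> carrier (rep_ring \<nu>)"
proof -
  show "initial \<nu> g = rep_hom \<nu> (Poly_Mapping.single \<alpha> g)"
    using assms
    by (auto simp: fun_eq_iff initial_def rep_hom_def[OF v] lookup_single when_def elt_set_plus_def)
  show "Poly_Mapping.single \<alpha> g \<in> carrier (rep_ring \<nu>)"
    using assms P_gt_0[OF v] P_gt_subset[OF v]
    by (auto simp: rep_ring_def[OF v] lookup_single when_def P_ge_def)
qed

lemma initial_mult: "initial \<nu> (f * g) = initial \<nu> f \<otimes>\<^bsub>graded_algebra \<nu>\<^esub> initial \<nu> g"
proof (cases "\<nu> f = Infty \<or> \<nu> g = Infty")
  case True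
  then have "\<nu> (f * g) = Infty" by (auto simp: val_mult[OF v])
  then show ?thesis
    using True initial_closed[OF v] by (auto simp: initial_Infty)
next
  case False
  then obtain \<alpha> \<gamma> where *: "\<nu> f = Fin \<alpha>" "\<nu> g = Fin \<gamma>"
    by (cases "\<nu> f"; cases "\<nu> g") auto
  then have "\<nu> (f * g) = Fin (\<alpha> + \<gamma>)" by (simp add: val_mult[OF v])
  then show ?thesis
    using * rep_hom_mult[OF v initial_conv_rep_hom(2)[OF *(1)] initial_conv_rep_hom(2)[OF *(2)]]
    by (simp add: initial_conv_rep_hom(1) mult_single)
qed

lemma initial_cong:
  assumes "\<nu> f < \<nu> (f - g)"
  shows "initial \<nu> f = initial \<nu> g"
proof -
  obtain \<alpha> where \<alpha>: "\<nu> f = Fin \<alpha>" using assms by (cases "\<nu> f") auto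
  have "\<nu> (f + (g - f)) = \<nu> f"
    using assms by (intro val_add_eq[OF v]) (simp add: val_diff_commute[OF v, of g f])
  then have "\<nu> g = Fin \<alpha>" using \<alpha> by simp
  moreover have "f +o P_gt \<nu> \<alpha> = g +o P_gt \<nu> \<alpha>"
    using assms \<alpha> unfolding coset_eq[OF v] by (simp add: P_gt_def)
  ultimately have "initial \<nu> f \<delta> = initial \<nu> g \<delta>" for \<delta>
    using \<alpha> by (cases "\<delta> = \<alpha>") (simp_all add: initial_def)
  then show ?thesis by (rule ext)
qed

lemma val_dvdI:
  assumes "\<nu> f < \<nu> (f - q * h)"
  shows "val_dvd \<nu> h f"
  unfolding val_dvd_def
proof (rule dividesI)
  show "initial \<nu> f = initial \<nu> h \<otimes>\<^bsub>graded_algebra \<nu>\<^esub> initial \<nu> q"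
    using initial_cong[OF assms] initial_mult[of h q] by (simp add: mult.commute)
qed (rule initial_closed[OF v])

lemma mem_PIdl_initial_iff:
  "initial \<nu> f \<in> PIdl\<^bsub>graded_algebra \<nu>\<^esub> (initial \<nu> h) \<longleftrightarrow> val_dvd \<nu> h f"
proof -
  have "c \<otimes>\<^bsub>graded_algebra \<nu>\<^esub> initial \<nu> h = initial \<nu> h \<otimes>\<^bsub>graded_algebra \<nu>\<^esub> c"
    if "c \<in> carrier (graded_algebra \<nu>)" for c
    using R.m_comm[OF that initial_closed[OF v]] .
  then show ?thesis
    unfolding cgenideal_def val_dvd_def factor_def mem_Collect_eq by metis
qed

lemma KP_lead_coeff: "\<chi> \<in> KP \<nu> \<Longrightarrow> lead_coeff \<chi> = 1"
  by (simp add: KP_def)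

lemma KP_not_val_dvd: "\<chi> \<in> KP \<nu> \<Longrightarrow> f \<noteq> 0 \<Longrightarrow> degree f < degree \<chi> \<Longrightarrow> \<not> val_dvd \<nu> \<chi> f"
  by (simp add: KP_def)

lemma KP_prime:
  assumes "\<chi> \<in> KP \<nu>" "val_dvd \<nu> \<chi> (f * g)"
  shows "val_dvd \<nu> \<chi> f \<or> val_dvd \<nu> \<chi> g"
proof -
  have "primeideal (PIdl\<^bsub>graded_algebra \<nu>\<^esub> (initial \<nu> \<chi>)) (graded_algebra \<nu>)"
    using assms(1) by (simp add: KP_def)
  from primeideal.I_prime[OF this initial_closed[OF v] initial_closed[OF v]] show ?thesis
    using assms(2) by (simp only: initial_mult[symmetric] mem_PIdl_initial_iff)
qed

lemma initial_1: "initial \<nu> 1 = \<one>\<^bsub>graded_algebra \<nu>\<^esub>"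
  using valuation_1[OF v] by (auto simp: initial_def graded_algebra_def zero_with_infty_def fun_eq_iff)

lemma KP_degree_pos:
  assumes \<chi>: "\<chi> \<in> KP \<nu>"
  shows "degree \<chi> > 0"
proof (rule ccontr)
  assume "\<not> degree \<chi> > 0"
  then have "\<chi> = 1" using KP_lead_coeff[OF \<chi>] by (auto elim!: degree_eq_zeroE simp: one_pCons)
  then have prime: "primeideal (PIdl\<^bsub>graded_algebra \<nu>\<^esub> \<one>\<^bsub>graded_algebra \<nu>\<^esub>) (graded_algebra \<nu>)"
    using \<chi> initial_1 by (simp add: KP_def)
  have "\<one>\<^bsub>graded_algebra \<nu>\<^esub> \<in> PIdl\<^bsub>graded_algebra \<nu>\<^esub> \<one>\<^bsub>graded_algebra \<nu>\<^esub>"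
    by (simp add: R.cgenideal_self)
  then have "PIdl\<^bsub>graded_algebra \<nu>\<^esub> \<one>\<^bsub>graded_algebra \<nu>\<^esub> = carrier (graded_algebra \<nu>)"
    using ideal.one_imp_carrier primeideal.axioms(1)[OF prime] by blast
  then show False using primeideal.I_notcarr[OF prime] by simp
qed

text \<open>
  A polynomial of infinite value has initial form zero, which everything divides.
\<close>
lemma KP_small_finite:
  assumes \<chi>: "\<chi> \<in> KP \<nu>" and f: "f \<noteq> 0" "degree f < degree \<chi>"
  shows "\<nu> f \<noteq> Infty"
proof
  assume "\<nu> f = Infty"
  then have "val_dvd \<nu> \<chi> f"
    using initial_closed[OF v, of \<chi>] unfolding val_dvd_def
    by (intro dividesI[of "\<zero>\<^bsub>graded_algebra \<nu>\<^esub>"]) (simp_all add: initial_Infty)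
  then show False using KP_not_val_dvd[OF \<chi> f] by simp
qed

text \<open>
  If the value of the sum exceeded that of \<open>r\<close>, then \<open>r\<close> and \<open>- q * \<chi>\<close> would have the same
  initial form, and \<open>\<chi>\<close> would divide the short polynomial \<open>r\<close>.
\<close>
lemma KP_remainder_le:
  assumes \<chi>: "\<chi> \<in> KP \<nu>" and r: "degree r < degree \<chi>"
  shows "\<nu> (q * \<chi> + r) \<le> \<nu> r"
proof (cases "r = 0")
  case False
  show ?thesis
  proof (rule ccontr)
    assume "\<not> ?thesis"
    then have "\<nu> r < \<nu> (r - (- q) * \<chi>)" by (simp add: add.commute)
    then show False using val_dvdI KP_not_val_dvd[OF \<chi> False r] by blast
  qed
qed (simp add: valuation_0[OF v])

text \<open>
  Primality in its polynomial form: \<open>in \<chi>\<close> would divide the initial form of one of the two short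
  factors.
\<close>
lemma KP_not_product:
  assumes \<chi>: "\<chi> \<in> KP \<nu>"
    and f: "f \<noteq> 0" "degree f < degree \<chi>" and g: "g \<noteq> 0" "degree g < degree \<chi>"
  shows "\<nu> (\<chi> - f * g) \<le> \<nu> \<chi>"
proof (rule ccontr)
  assume "\<not> ?thesis"
  then have "initial \<nu> \<chi> = initial \<nu> (f * g)" by (intro initial_cong) simp
  then have "val_dvd \<nu> \<chi> (f * g)"
    using R.divides_refl initial_closed[OF v] by (simp add: val_dvd_def)
  then show False using KP_prime KP_not_val_dvd \<chi> f g by blast
qed

text \<open>
  The \<open>\<chi>\<close>-expansion has no cancellation: repeated division with remainder reduces this to
  \<open>KP_remainder_le\<close>.
\<close>
lemma KP_expansion_le:
  assumes \<chi>: "\<chi> \<in> KP \<nu>"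
  shows "\<nu> f \<le> \<nu> (adic_coeff \<chi> f s * \<chi> ^ s)"
proof -
  have split: "f div \<chi> ^ s = (f div \<chi> ^ Suc s) * \<chi> + adic_coeff \<chi> f s" for s
    unfolding adic_coeff_def power_Suc2 poly_div_mult_right by (rule div_mult_mod_eq[symmetric])
  have le: "\<nu> (f div \<chi> ^ s) \<le> \<nu> (adic_coeff \<chi> f s)" for s
    by (subst split, rule KP_remainder_le[OF \<chi>])
      (rule degree_adic_coeff[OF KP_degree_pos[OF \<chi>]])
  have "\<nu> f \<le> \<nu> ((f div \<chi> ^ s) * \<chi> ^ s)"
  proof (induction s)
    case (Suc s)
    let ?q = "f div \<chi> ^ Suc s"
    have "min (\<nu> (f div \<chi> ^ s)) (\<nu> (adic_coeff \<chi> f s)) \<le> \<nu> (f div \<chi> ^ s - adic_coeff \<chi> f s)"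
      by (rule val_diff[OF v])
    then have "\<nu> (f div \<chi> ^ s) \<le> \<nu> (?q * \<chi>)"
      using le[of s] split[of s] by (simp add: min_def)
    then have "\<nu> ((f div \<chi> ^ s) * \<chi> ^ s) \<le> \<nu> (?q * \<chi>) + \<nu> (\<chi> ^ s)"
      by (simp add: val_mult[OF v] add_right_mono)
    then show ?case using Suc by (simp add: val_mult[OF v] add.assoc)
  qed simp
  also have "\<dots> \<le> \<nu> (adic_coeff \<chi> f s * \<chi> ^ s)"
    using le[of s] by (simp add: val_mult[OF v] add_right_mono)
  finally show ?thesis .
qed

end

text \<open>
  The values of \<open>a\<close> and of its inverse add up to zero for both valuations, so neither can grow.
\<close>
lemma val_const_agree:
  fixes \<mu> \<nu> :: "'k :: field poly \<Rightarrow> 'g :: linordered_ab_group_add with_infty"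
  assumes \<mu>: "valuation \<mu>" and \<nu>: "valuation \<nu>" and le: "\<And>f. \<mu> f \<le> \<nu> f"
  shows "\<mu> [:a:] = \<nu> [:a:]"
proof (cases "a = 0")
  case False
  have "w [:a:] + w [:inverse a:] = Fin 0"
    if w: "valuation w" for w :: "'k poly \<Rightarrow> 'g with_infty"
    using val_mult[OF w, of "[:a:]" "[:inverse a:]"] valuation_1[OF w] False
    by (simp add: zero_with_infty_def one_pCons)
  from this[OF \<mu>] this[OF \<nu>] le[of "[:a:]"] le[of "[:inverse a:]"] show ?thesis
    by (cases "\<mu> [:a:]"; cases "\<nu> [:a:]"; cases "\<mu> [:inverse a:]"; cases "\<nu> [:inverse a:]")
      (auto, metis add_left_mono add_le_cancel_right antisym)
qed (simp add: valuation_0[OF \<mu>] valuation_0[OF \<nu>])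

text \<open>
  A polynomial \<open>f\<close> of least degree with \<open>\<mu> f < \<nu> f\<close> would satisfy \<open>\<mu> r > \<mu> \<chi>\<close> for the remainder \<open>r\<close> of
  \<open>\<chi>\<close> modulo \<open>f\<close>: otherwise \<open>\<mu> r = \<nu> r < \<nu> \<chi>\<close> would make \<open>\<nu> (q * f)\<close> equal to \<open>\<mu> r\<close>, hence at most
  \<open>\<mu> (q * f)\<close>, although the value of \<open>f\<close> grows. So \<open>\<chi>\<close> would have the initial form of the product \<open>q * f\<close> of two shorter polynomials.
\<close>
lemma KP_small_agree:
  fixes \<mu> \<nu> :: "'k :: field poly \<Rightarrow> 'g :: linordered_ab_group_add with_infty"
  assumes \<mu>: "valuation \<mu>" and \<nu>: "valuation \<nu>" and le: "\<And>f. \<mu> f \<le> \<nu> f"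
    and \<chi>: "\<chi> \<in> KP \<mu>" and less: "\<mu> \<chi> < \<nu> \<chi>"
  shows "degree f < degree \<chi> \<Longrightarrow> \<mu> f = \<nu> f"
proof (induction "degree f" arbitrary: f rule: less_induct)
  case less_f: less
  show ?case
  proof (rule ccontr)
    assume "\<mu> f \<noteq> \<nu> f"
    then have f: "\<mu> f < \<nu> f" using le[of f] by (simp add: order.order_iff_strict)
    have f0: "f \<noteq> 0" using f valuation_0[OF \<mu>] by auto
    \<comment> \<open>Constants are excluded first, so that the quotient is shorter than \<open>\<chi>\<close>.\<close>
    have deg: "degree f > 0"
      using val_const_agree[OF \<mu> \<nu> le] f by (metis degree_eq_zeroE gr0I less_irrefl)
    define q r where "q = \<chi> div f" and "r = \<chi> mod f"
    have qr: "\<chi> = q * f + r" by (simp add: q_def r_def)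
    have "degree r < degree f" using deg degree_mod_less[OF f0, of \<chi>] by (auto simp: r_def)
    then have r: "\<mu> r = \<nu> r" using less_f by simp
    have "q \<noteq> 0"
      using less_f.prems f0 by (auto simp: q_def div_poly_eq_0_iff)
    have "degree (q * f) \<le> degree \<chi>"
      using degree_diff_le[of \<chi> "degree \<chi>" r] \<open>degree r < degree f\<close> less_f.prems qr by simp
    then have dq: "degree q < degree \<chi>"
      using deg \<open>q \<noteq> 0\<close> f0 by (simp add: degree_mult_eq)
    have "\<mu> (\<chi> - q * f) \<le> \<mu> \<chi>"
      by (rule KP_not_product[OF \<mu> \<chi> \<open>q \<noteq> 0\<close> dq f0 less_f.prems])
    then have r_le: "\<mu> r \<le> \<mu> \<chi>" by (simp add: qr)
    have qf: "\<nu> (q * f) = \<mu> r"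
    proof -
      have "\<nu> r < \<nu> \<chi>" using r r_le less by simp
      then have "\<nu> (- r + \<chi>) = \<nu> (- r)"
        by (intro val_add_eq[OF \<nu>]) (simp add: valuation_minus[OF \<nu>])
      then show ?thesis using r qr by (simp add: valuation_minus[OF \<nu>])
    qed
    have "\<mu> r \<le> \<mu> (q * f)"
      using val_diff[OF \<mu>, of \<chi> r] r_le by (simp add: min_def qr split: if_splits)
    then have "\<nu> (q * f) \<le> \<mu> (q * f)" by (simp add: qf)
    moreover have "\<nu> (q * f) \<noteq> Infty"
      using r_le less unfolding qf by (cases "\<mu> r"; cases "\<mu> \<chi>") simp_all
    then obtain c d where cd: "\<nu> q = Fin c" "\<nu> f = Fin d"
      unfolding val_mult[OF \<nu>] by (cases "\<nu> q"; cases "\<nu> f") simp_all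
    moreover obtain c' where c': "\<mu> q = Fin c'" "c' \<le> c"
      using le[of q] cd by (cases "\<mu> q") simp_all
    moreover obtain d' where d': "\<mu> f = Fin d'" "d' < d"
      using f cd by (cases "\<mu> f") simp_all
    ultimately have "c + d \<le> c' + d'" by (simp add: val_mult[OF \<mu>] val_mult[OF \<nu>])
    then show False using add_le_less_mono[OF c'(2) d'(2)] by simp
  qed
qed


section \<open>Truncations and augmentations\<close>

lemma adic_coeff_linear:
  fixes \<chi> a b :: "'k :: field poly"
  assumes "degree a < degree \<chi>" "degree b < degree \<chi>"
  shows "adic_coeff \<chi> (a + b * \<chi>) s = (if s = 0 then a else if s = 1 then b else 0)"
proof -
  have "adic_coeff \<chi> (\<Sum>s<2. (if s = 0 then a else if s = 1 then b else 0) * \<chi> ^ s) s =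
      (if s < 2 then (if s = 0 then a else if s = 1 then b else 0) else 0)"
    by (rule adic_expansion_unique) (use assms in auto)
  then show ?thesis by (auto simp: numeral_2_eq_2)
qed

context
  fixes \<mu> :: "'k :: field poly \<Rightarrow> 'g :: linordered_ab_group_add with_infty"
    and \<chi> :: "'k poly" and \<beta> :: 'g
  assumes v: "valuation \<mu>" and pos: "degree \<chi> > 0"
begin

lemma augmentation_le:
  "augmentation \<mu> \<chi> \<beta> f \<le> \<mu> (adic_coeff \<chi> f s) + Fin (nsmul s \<beta>)"
proof (cases "s \<le> degree f")
  case True
  then show ?thesis unfolding augmentation_def by (intro Min_le) auto
qed (simp add: adic_coeff_beyond(2)[OF pos] valuation_0[OF v])

lemma augmentation_attained:
  obtains s where "augmentation \<mu> \<chi> \<beta> f = \<mu> (adic_coeff \<chi> f s) + Fin (nsmul s \<beta>)"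
proof -
  have "augmentation \<mu> \<chi> \<beta> f \<in> (\<lambda>s. \<mu> (adic_coeff \<chi> f s) + Fin (nsmul s \<beta>)) ` {..degree f}"
    unfolding augmentation_def by (rule Min_in) auto
  then show thesis using that by blast
qed

lemma augmentation_translate:
  assumes "degree a < degree \<chi>"
  shows "augmentation \<mu> \<chi> \<beta> (\<chi> + a) = min (\<mu> a) (Fin \<beta>)"
proof (rule antisym)
  have c: "adic_coeff \<chi> (\<chi> + a) s = (if s = 0 then a else if s = 1 then 1 else 0)" for s
    using adic_coeff_linear[of a \<chi> 1 s] assms pos by (simp add: add.commute)
  show "augmentation \<mu> \<chi> \<beta> (\<chi> + a) \<le> min (\<mu> a) (Fin \<beta>)"
    using augmentation_le[of "\<chi> + a" 0] augmentation_le[of "\<chi> + a" 1] c[of 0] c[of 1]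
    by (simp add: zero_with_infty_def[symmetric] valuation_1[OF v])
  obtain s where "augmentation \<mu> \<chi> \<beta> (\<chi> + a) = \<mu> (adic_coeff \<chi> (\<chi> + a) s) + Fin (nsmul s \<beta>)"
    by (rule augmentation_attained)
  then show "min (\<mu> a) (Fin \<beta>) \<le> augmentation \<mu> \<chi> \<beta> (\<chi> + a)"
    using c[of s]
    by (auto simp: valuation_0[OF v] valuation_1[OF v] zero_with_infty_def[symmetric])
qed

end

lemma truncation_le:
  assumes "valuation \<nu>" "valuation \<mu>" "degree Q > 0"
    and "\<And>s. \<nu> (adic_coeff Q f s * Q ^ s) \<le> \<mu> (adic_coeff Q f s * Q ^ s)"
  shows "truncation \<nu> Q f \<le> \<mu> f"
proof -
  have "truncation \<nu> Q f \<le> \<mu> (\<Sum>s\<le>degree f. adic_coeff Q f s * Q ^ s)"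
  proof (rule val_sum_ge[OF assms(2)])
    fix s assume "s \<in> {..degree f}"
    then have "truncation \<nu> Q f \<le> \<nu> (adic_coeff Q f s * Q ^ s)"
      unfolding truncation_def by (intro Min_le) auto
    then show "truncation \<nu> Q f \<le> \<mu> (adic_coeff Q f s * Q ^ s)"
      using assms(4)[of s] by (rule order_trans)
  qed
  then show ?thesis using adic_expansion[OF assms(3), of f] by simp
qed

lemma augmentation_eq_truncation:
  assumes "valuation \<nu>" "degree \<chi> > 0" "\<nu> \<chi> = Fin \<beta>"
    and "\<And>a. degree a < degree \<chi> \<Longrightarrow> \<mu> a = \<nu> a"
  shows "augmentation \<mu> \<chi> \<beta> = truncation \<nu> \<chi>"
  unfolding augmentation_def truncation_def fun_eq_iff
  using assms degree_adic_coeff[OF assms(2)]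
  by (simp add: val_mult[OF assms(1)] val_power[OF assms(1)] nsmul_Fin)


section \<open>Taylor expansions and abstract key polynomials\<close>

text \<open>
  \<open>f(x + y)\<close> as a polynomial in \<open>y\<close>; unlike the individual Hasse derivatives it is multiplicative in
  \<open>f\<close>.
\<close>
definition taylor :: "'k :: field poly \<Rightarrow> 'k poly poly" where
  "taylor f = pcompose (map_poly (\<lambda>c. [:c:]) f) [:[:0, 1:], 1:]"

lemma hasse_deriv_conv_taylor: "hasse_deriv b f = coeff (taylor f) b"
  by (simp add: hasse_deriv_def taylor_def)

lemma taylor_mult: "taylor (f * g) = taylor f * taylor g"
proof -
  have "map_poly (\<lambda>c. [:c:]) (f * g) = map_poly (\<lambda>c. [:c:]) f * map_poly (\<lambda>c. [:c:]) g"
    by (intro poly_eqI) (simp add: coeff_map_poly coeff_mult sum_to_poly mult.commute)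
  then show ?thesis by (simp add: taylor_def pcompose_mult)
qed

lemma taylor_add: "taylor (f + g) = taylor f + taylor g"
proof -
  have "map_poly (\<lambda>c. [:c:]) (f + g) = map_poly (\<lambda>c. [:c:]) f + map_poly (\<lambda>c. [:c:]) g"
    by (intro poly_eqI) (simp add: coeff_map_poly)
  then show ?thesis by (simp add: taylor_def pcompose_add)
qed

lemma taylor_0: "taylor 0 = 0"
  by (simp add: taylor_def)

lemma taylor_1: "taylor 1 = 1"
  by (simp add: taylor_def one_pCons map_poly_pCons)

lemma taylor_sum: "taylor (\<Sum>i\<in>I. f i) = (\<Sum>i\<in>I. taylor (f i))"
  by (induction I rule: infinite_finite_induct) (simp_all add: taylor_0 taylor_add)

lemma taylor_power: "taylor (f ^ n) = taylor f ^ n"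
  by (induction n) (simp_all add: taylor_1 taylor_mult)

lemma hasse_deriv_0: "hasse_deriv 0 f = f"
proof -
  have "poly (taylor f) 0 = poly (map_poly (\<lambda>c. [:c:]) f) [:0, 1:]"
    by (simp add: taylor_def poly_pcompose)
  also have "\<dots> = pcompose f [:0, 1:]" by (simp add: pcompose_altdef)
  finally show ?thesis by (simp add: hasse_deriv_conv_taylor poly_0_coeff_0)
qed

text \<open>
  The value of the monomial \<open>coeff F b * y ^ b\<close> in the Gauss extension of \<open>\<mu>\<close> in which \<open>y\<close> has
  value \<open>a\<close>.
\<close>
definition weight ::
    "('k :: field poly \<Rightarrow> 'g :: linordered_ab_group_add with_infty) \<Rightarrow> 'g \<Rightarrow> 'k poly poly \<Rightarrow>
     nat \<Rightarrow> 'g with_infty" where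
  "weight \<mu> a F b = \<mu> (coeff F b) + Fin (nsmul b a)"

text \<open>
  The Gauss extension takes the value \<open>c\<close> at \<open>F\<close>, and the initial form of \<open>F\<close> has degree \<open>d\<close> in \<open>y\<close>.
  Both numbers add up under products, and keeping track of \<open>d\<close> is what excludes cancellation in
  sums.
\<close>
definition top_weight ::
    "('k :: field poly \<Rightarrow> 'g :: linordered_ab_group_add with_infty) \<Rightarrow> 'g \<Rightarrow> 'k poly poly \<Rightarrow>
     'g \<Rightarrow> nat \<Rightarrow> bool" where
  "top_weight \<mu> a F c d \<longleftrightarrow>
     (\<forall>b. Fin c \<le> weight \<mu> a F b) \<and> weight \<mu> a F d = Fin c \<and> (\<forall>b>d. Fin c < weight \<mu> a F b)"

context
  fixes \<mu> :: "'k :: field poly \<Rightarrow> 'g :: linordered_ab_group_add with_infty" and a :: 'g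
  assumes v: "valuation \<mu>"
begin

lemma weight_mult_term:
  "i \<le> k \<Longrightarrow> \<mu> (coeff F i * coeff G (k - i)) + Fin (nsmul k a) = weight \<mu> a F i + weight \<mu> a G (k - i)"
  using nsmul_add[of i "k - i" a]
  by (cases "\<mu> (coeff F i)"; cases "\<mu> (coeff G (k - i))")
    (simp_all add: weight_def val_mult[OF v] algebra_simps)

lemma weight_conv_le:
  "Fin c \<le> weight \<mu> a F b \<longleftrightarrow> Fin (c - nsmul b a) \<le> \<mu> (coeff F b)"
  and weight_conv_less:
  "Fin c < weight \<mu> a F b \<longleftrightarrow> Fin (c - nsmul b a) < \<mu> (coeff F b)"
  and weight_conv_eq:
  "weight \<mu> a F b = Fin c \<longleftrightarrow> \<mu> (coeff F b) = Fin (c - nsmul b a)"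
  unfolding weight_def by (cases "\<mu> (coeff F b)"; auto simp: algebra_simps)+

lemma weight_sum_eq:
  assumes "finite I" "t \<in> I" "weight \<mu> a (F t) b = Fin c"
    and "\<And>i. i \<in> I \<Longrightarrow> i \<noteq> t \<Longrightarrow> Fin c < weight \<mu> a (F i) b"
  shows "weight \<mu> a (sum F I) b = Fin c"
proof -
  have "Fin (c - nsmul b a) < \<mu> (\<Sum>i\<in>I - {t}. coeff (F i) b)"
    using assms(4) by (intro val_sum_gt[OF v]) (auto simp: weight_conv_less)
  then have "\<mu> (coeff (F t) b + (\<Sum>i\<in>I - {t}. coeff (F i) b)) = \<mu> (coeff (F t) b)"
    using assms(3) by (intro val_add_eq[OF v]) (simp add: weight_conv_eq)
  then show ?thesis
    using assms(1-3) by (simp add: weight_conv_eq coeff_sum sum.remove[of I t])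
qed

lemma weight_mult_ge:
  assumes "\<And>i. i \<le> k \<Longrightarrow> Fin c \<le> weight \<mu> a F i + weight \<mu> a G (k - i)"
  shows "Fin c \<le> weight \<mu> a (F * G) k"
  unfolding weight_conv_le coeff_mult
proof (rule val_sum_ge[OF v])
  fix i assume "i \<in> {..k}"
  then have "Fin c \<le> \<mu> (coeff F i * coeff G (k - i)) + Fin (nsmul k a)"
    using assms[of i] weight_mult_term[of i k F G] by simp
  then show "Fin (c - nsmul k a) \<le> \<mu> (coeff F i * coeff G (k - i))"
    by (cases "\<mu> (coeff F i * coeff G (k - i))") (auto simp: algebra_simps)
qed

lemma weight_mult_gt:
  assumes "\<And>i. i \<le> k \<Longrightarrow> Fin c < weight \<mu> a F i + weight \<mu> a G (k - i)"
  shows "Fin c < weight \<mu> a (F * G) k"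
  unfolding weight_conv_less coeff_mult
proof (rule val_sum_gt[OF v])
  fix i assume "i \<in> {..k}"
  then have "Fin c < \<mu> (coeff F i * coeff G (k - i)) + Fin (nsmul k a)"
    using assms[of i] weight_mult_term[of i k F G] by simp
  then show "Fin (c - nsmul k a) < \<mu> (coeff F i * coeff G (k - i))"
    by (cases "\<mu> (coeff F i * coeff G (k - i))") (auto simp: algebra_simps)
qed

lemma weight_mult_eq:
  assumes t: "t \<le> k" "weight \<mu> a F t + weight \<mu> a G (k - t) = Fin c"
    and gt: "\<And>i. i \<le> k \<Longrightarrow> i \<noteq> t \<Longrightarrow> Fin c < weight \<mu> a F i + weight \<mu> a G (k - i)"
  shows "weight \<mu> a (F * G) k = Fin c"
proof -
  let ?p = "\<lambda>i. coeff F i * coeff G (k - i)"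
  have "\<mu> (?p t) + Fin (nsmul k a) = Fin c"
    using weight_mult_term[OF t(1), of F G] t(2) by simp
  then have eq: "\<mu> (?p t) = Fin (c - nsmul k a)"
    by (cases "\<mu> (?p t)") (auto simp: algebra_simps)
  have "Fin (c - nsmul k a) < \<mu> (\<Sum>i\<in>{..k} - {t}. ?p i)"
  proof (rule val_sum_gt[OF v])
    fix i assume "i \<in> {..k} - {t}"
    then have "Fin c < \<mu> (?p i) + Fin (nsmul k a)"
      using gt[of i] weight_mult_term[of i k F G] by simp
    then show "Fin (c - nsmul k a) < \<mu> (?p i)"
      by (cases "\<mu> (?p i)") (auto simp: algebra_simps)
  qed
  then have "\<mu> (?p t + (\<Sum>i\<in>{..k} - {t}. ?p i)) = \<mu> (?p t)"
    by (intro val_add_eq[OF v]) (simp add: eq)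
  moreover have "coeff (F * G) k = ?p t + (\<Sum>i\<in>{..k} - {t}. ?p i)"
    using t(1) by (simp add: coeff_mult sum.remove[of "{..k}" t])
  ultimately show ?thesis using eq by (simp add: weight_conv_eq)
qed

text \<open>
  As for Gauss's lemma: in degree \<open>d + d'\<close> only the product of the two top terms reaches the
  minimum \<open>c + c'\<close>, and in larger degrees no product does.
\<close>
lemma top_weight_mult:
  assumes F: "top_weight \<mu> a F c d" and G: "top_weight \<mu> a G c' d'"
  shows "top_weight \<mu> a (F * G) (c + c') (d + d')"
proof -
  have ge: "Fin c \<le> weight \<mu> a F i" "Fin c' \<le> weight \<mu> a G i" for i
    using F G by (auto simp: top_weight_def)
  have gt: "Fin (c + c') < weight \<mu> a F i + weight \<mu> a G j" if "i > d \<or> j > d'" for i j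
  proof -
    have "Fin c < weight \<mu> a F i \<or> Fin c' < weight \<mu> a G j"
      using that F G by (auto simp: top_weight_def)
    then show ?thesis using ge(1)[of i] ge(2)[of j]
      by (cases "weight \<mu> a F i"; cases "weight \<mu> a G j")
        (auto intro: add_less_le_mono add_le_less_mono)
  qed
  show ?thesis unfolding top_weight_def
  proof (intro conjI allI impI)
    show "Fin (c + c') \<le> weight \<mu> a (F * G) b" for b
    proof (rule weight_mult_ge)
      fix i assume "i \<le> b"
      show "Fin (c + c') \<le> weight \<mu> a F i + weight \<mu> a G (b - i)"
        using add_mono[OF ge(1)[of i] ge(2)[of "b - i"]] by simp
    qed
    show "Fin (c + c') < weight \<mu> a (F * G) b" if "b > d + d'" for b
      using that by (intro weight_mult_gt gt) linarith
    show "weight \<mu> a (F * G) (d + d') = Fin (c + c')"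
    proof (rule weight_mult_eq[of d])
      show "weight \<mu> a F d + weight \<mu> a G (d + d' - d) = Fin (c + c')"
        using F G by (simp add: top_weight_def)
      show "Fin (c + c') < weight \<mu> a F i + weight \<mu> a G (d + d' - i)"
        if "i \<le> d + d'" "i \<noteq> d" for i
        using that by (intro gt) linarith
    qed simp
  qed
qed

lemma top_weight_power:
  assumes "top_weight \<mu> a F c d"
  shows "top_weight \<mu> a (F ^ n) (nsmul n c) (n * d)"
proof (induction n)
  case 0
  show ?case
    using valuation_1[OF v] valuation_0[OF v]
    by (auto simp: top_weight_def weight_def coeff_1 zero_with_infty_def)
next
  case (Suc n)
  then show ?case using top_weight_mult[OF assms] by simp
qed

text \<open>
  Among the summands of least value, the one whose initial form has the largest degree in \<open>y\<close> is
  alone in that degree, so the sum has no larger value than the least of its summands.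
\<close>
lemma top_weight_sum_ge:
  assumes fin: "finite I" and top: "\<And>i. i \<in> I \<Longrightarrow> top_weight \<mu> a (F i) (c i) (e i)"
    and inj: "inj_on e I" and i: "i \<in> I"
    and ge: "\<And>b. Fin C \<le> weight \<mu> a (sum F I) b"
  shows "C \<le> c i"
proof -
  define M where "M = Min (c ` I)"
  have M: "M \<le> c j" if "j \<in> I" for j using that fin by (simp add: M_def)
  let ?J = "{j \<in> I. c j = M}"
  have "M \<in> c ` I" unfolding M_def using fin i by (intro Min_in) auto
  then have J: "finite ?J" "?J \<noteq> {}" using fin by auto
  have "Max (e ` ?J) \<in> e ` ?J" using J by (intro Max_in) simp_all
  then obtain t where t: "t \<in> ?J" "e t = Max (e ` ?J)" by force
  have "weight \<mu> a (sum F I) (e t) = Fin M"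
  proof (rule weight_sum_eq[OF fin])
    show "t \<in> I" "weight \<mu> a (F t) (e t) = Fin M"
      using t(1) top[of t] by (auto simp: top_weight_def)
    fix j assume j: "j \<in> I" "j \<noteq> t"
    show "Fin M < weight \<mu> a (F j) (e t)"
    proof (cases "c j = M")
      case True
      then have "e j \<le> e t" using j t J by simp
      moreover have "e j \<noteq> e t" using inj j t(1) by (auto dest: inj_onD)
      ultimately show ?thesis using top[OF j(1)] True by (auto simp: top_weight_def)
    next
      case False
      then have "Fin M < Fin (c j)" using M[OF j(1)] by simp
      also have "\<dots> \<le> weight \<mu> a (F j) (e t)" using top[OF j(1)] by (simp add: top_weight_def)
      finally show ?thesis .
    qed
  qed
  then show ?thesis using ge[of "e t"] M[OF i] by simp
qed

end


text \<open>
  Multiplying \<open>\<nu>\<close> by \<open>n\<close> clears the denominator of a value \<open>hull_frac a n\<close> of \<open>y\<close>, which then becomes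
  the element \<open>a\<close> of the value group. The Gauss extension thus needs no arithmetic in the divisible
  hull.
\<close>
lemma valuation_nsmul:
  fixes \<nu> :: "'k :: field poly \<Rightarrow> 'g :: linordered_ab_group_add with_infty"
  assumes v: "valuation \<nu>" and n: "n > 0"
  shows "valuation (\<lambda>f. nsmul n (\<nu> f))"
proof -
  have mult: "nsmul n (\<nu> (f * g)) = nsmul n (\<nu> f) + nsmul n (\<nu> g)" for f g
    by (simp add: val_mult[OF v] nsmul_distrib)
  have add: "min (nsmul n (\<nu> f)) (nsmul n (\<nu> g)) \<le> nsmul n (\<nu> (f + g))" for f g
  proof -
    have "nsmul n (min (\<nu> f) (\<nu> g)) \<le> nsmul n (\<nu> (f + g))"
      by (intro nsmul_with_infty_mono val_add[OF v])
    then show ?thesis by (auto simp: min_def split: if_splits intro: order_trans)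
  qed
  have zero: "nsmul n (\<nu> [:a:]) = Infty \<longleftrightarrow> a = 0" for a
    using n by (cases "\<nu> [:a:]") (simp_all add: nsmul_Fin nsmul_Infty flip: val_const_Infty_iff[OF v])
  have "field_valuation (\<lambda>a. nsmul n (\<nu> [:a:]))"
    unfolding field_valuation_def
  proof (intro conjI allI)
    show "nsmul n (\<nu> [:a * b:]) = nsmul n (\<nu> [:a:]) + nsmul n (\<nu> [:b:])" for a b
      using mult[of "[:a:]" "[:b:]"] by (simp add: mult.commute)
    show "min (nsmul n (\<nu> [:a:])) (nsmul n (\<nu> [:b:])) \<le> nsmul n (\<nu> [:a + b:])" for a b
      using add[of "[:a:]" "[:b:]"] by simp
  qed (rule zero)
  then show ?thesis unfolding valuation_def using mult add by blast
qed

context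
  fixes \<nu> :: "'k :: field poly \<Rightarrow> 'g :: linordered_ab_group_add with_infty"
  assumes v: "valuation \<nu>"
begin

lemma epsilon_attained:
  assumes "degree f > 0" "\<nu> f = Fin x"
  obtains n y where "n > 0" "\<nu> (hasse_deriv n f) = Fin y" "epsilon \<nu> f = Fin (hull_frac (x - y) n)"
proof -
  have "Max (epsilon_set \<nu> f) \<in> epsilon_set \<nu> f"
    by (intro Max_in epsilon_set_finite epsilon_set_nonempty v assms)
  then obtain n where n: "n \<ge> 1" "\<nu> (hasse_deriv n f) \<noteq> Infty"
    and max: "Max (epsilon_set \<nu> f) = hull_frac (the_fin (\<nu> f) - the_fin (\<nu> (hasse_deriv n f))) n"
    unfolding epsilon_set_def by auto
  obtain y where "\<nu> (hasse_deriv n f) = Fin y" using n by (cases "\<nu> (hasse_deriv n f)") auto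
  then show thesis using that[of n y] n max assms(2) by (simp add: epsilon_def)
qed

lemma hull_frac_le_epsilon:
  assumes "\<nu> f = Fin x" "\<nu> (hasse_deriv b f) = Fin y" "b > 0"
  shows "Fin (hull_frac (x - y) b) \<le> epsilon \<nu> f"
proof -
  have "hull_frac (x - y) b \<in> epsilon_set \<nu> f"
    unfolding epsilon_set_def using assms by (auto intro!: exI[of _ b])
  then show ?thesis using assms(1) epsilon_set_finite[OF v, of f] by (simp add: epsilon_def)
qed

lemma nsmul_le_diff_iff:
  fixes x y z :: 'g
  shows "nsmul n x \<le> nsmul n y + z \<longleftrightarrow> nsmul n (x - y) \<le> z"
  using nsmul_distrib[of n "x - y" y] by (auto simp: algebra_simps)

context
  fixes n :: nat and a :: 'g
  assumes n: "n > 0"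
begin

abbreviation (input) taylor_weight :: "'k poly \<Rightarrow> nat \<Rightarrow> 'g with_infty" where
  "taylor_weight f \<equiv> weight (\<lambda>f. nsmul n (\<nu> f)) a (taylor f)"

lemma weight_taylor_0: "\<nu> f = Fin x \<Longrightarrow> taylor_weight f 0 = Fin (nsmul n x)"
  by (simp add: weight_def hasse_deriv_0 nsmul_Fin flip: hasse_deriv_conv_taylor)

lemma weight_taylor_ge:
  assumes x: "\<nu> f = Fin x" and eps: "epsilon \<nu> f \<le> Fin (hull_frac a n)"
  shows "Fin (nsmul n x) \<le> taylor_weight f b"
proof (cases "b = 0 \<or> \<nu> (hasse_deriv b f) = Infty")
  case True
  then show ?thesis
    using weight_taylor_0[OF x] n
    by (auto simp: weight_def nsmul_Infty simp flip: hasse_deriv_conv_taylor)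
next
  case False
  then obtain y where y: "\<nu> (hasse_deriv b f) = Fin y" and b: "b > 0"
    by (cases "\<nu> (hasse_deriv b f)") auto
  have "hull_frac (x - y) b \<le> hull_frac a n"
    using order_trans[OF hull_frac_le_epsilon[OF x y b] eps] by simp
  then show ?thesis
    using b n y
    by (simp add: hull_frac_le_iff weight_def nsmul_Fin nsmul_le_diff_iff
        flip: hasse_deriv_conv_taylor)
qed

lemma weight_taylor_gt:
  assumes x: "\<nu> f = Fin x" and eps: "degree f > 0 \<Longrightarrow> epsilon \<nu> f < Fin (hull_frac a n)"
    and b: "b > 0"
  shows "Fin (nsmul n x) < taylor_weight f b"
proof (cases "\<nu> (hasse_deriv b f)")
  case (Fin y)
  then have "degree f > 0"
    using hasse_deriv_beyond[of f b] b valuation_0[OF v] by (cases "degree f = 0") auto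
  then have "hull_frac (x - y) b < hull_frac a n"
    using hull_frac_le_epsilon[OF x Fin b] eps
    by (metis less_with_infty_simps(1) order_le_less_trans)
  then have "\<not> hull_frac a n \<le> hull_frac (x - y) b" by (simp only: not_le)
  then have "\<not> nsmul b a \<le> nsmul n (x - y)" unfolding hull_frac_le_iff[OF n b] .
  then show ?thesis
    using Fin nsmul_distrib[of n "x - y" y]
    by (simp add: weight_def nsmul_Fin algebra_simps flip: hasse_deriv_conv_taylor)
next
  case Infty
  then show ?thesis using n
    by (simp add: weight_def nsmul_Infty flip: hasse_deriv_conv_taylor)
qed

end

end

text \<open>
  Take for \<open>f\<close> a shortest counterexample. All non-constant polynomials shorter than \<open>f\<close> then have
  smaller \<open>\<epsilon>\<close>, so in the Gauss extension at \<open>\<epsilon> f\<close> the initial forms of the coefficients of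
  \<open>f\<close>-expansions do not involve \<open>y\<close>, while that of \<open>f\<close> does. This separates the terms of the
  \<open>f\<close>-expansion of \<open>Q\<close>, so none of them has value below \<open>\<nu> Q\<close>, and \<open>\<mu> Q < \<nu> Q\<close> fails.
\<close>
lemma abstract_key_polynomialI:
  fixes \<mu> \<nu> :: "'k :: field poly \<Rightarrow> 'g :: linordered_ab_group_add with_infty"
  assumes \<mu>: "valuation \<mu>" and \<nu>: "valuation \<nu>"
    and Q: "lead_coeff Q = 1" "degree Q > 0"
    and agree: "\<And>f. degree f < degree Q \<Longrightarrow> \<mu> f = \<nu> f"
    and finite: "\<And>f. f \<noteq> 0 \<Longrightarrow> degree f < degree Q \<Longrightarrow> \<nu> f \<noteq> Infty"
    and less: "\<mu> Q < \<nu> Q"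
  shows "abstract_key_polynomial \<nu> Q"
proof (rule ccontr)
  assume "\<not> ?thesis"
  then have ex: "\<exists>f. (0 < degree f \<and> degree f < degree Q) \<and> \<not> epsilon \<nu> f < epsilon \<nu> Q"
    using Q by (auto simp: abstract_key_polynomial_def)
  define bad where "bad = (\<lambda>f. (0 < degree f \<and> degree f < degree Q) \<and> \<not> epsilon \<nu> f < epsilon \<nu> Q)"
  define f where "f = arg_min degree bad"
  have "bad f" and minimal: "\<And>g. bad g \<Longrightarrow> degree f \<le> degree g"
    using ex arg_min_nat_lemma[of bad _ degree] unfolding bad_def[symmetric] f_def by blast+
  then have f: "0 < degree f" "degree f < degree Q" and eps: "epsilon \<nu> Q \<le> epsilon \<nu> f"
    by (auto simp: bad_def not_less)
  have smaller: "epsilon \<nu> g < epsilon \<nu> f" if "0 < degree g" "degree g < degree f" for g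
    using minimal[of g] that f eps by (force simp: bad_def intro: order_less_le_trans)
  obtain x where x: "\<nu> f = Fin x" using finite[of f] f by (cases "\<nu> f"; cases "f = 0") auto
  obtain n y where n: "n > 0" and y: "\<nu> (hasse_deriv n f) = Fin y"
    and eps_f: "epsilon \<nu> f = Fin (hull_frac (x - y) n)"
    using epsilon_attained[OF \<nu> f(1) x] by blast
  define a where "a = x - y"
  have eps_a: "epsilon \<nu> f = Fin (hull_frac a n)" using eps_f by (simp add: a_def)
  obtain z where z: "\<nu> Q = Fin z" using eps eps_f by (cases "\<nu> Q") (auto simp: epsilon_def)
  let ?\<nu> = "\<lambda>f. nsmul n (\<nu> f)"
  note vn = valuation_nsmul[OF \<nu> n]
  have wn: "weight ?\<nu> a (taylor f) n = Fin (nsmul n x)"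
    using nsmul_distrib[of n "x - y" y] y
    by (simp add: weight_def a_def nsmul_Fin add.commute flip: hasse_deriv_conv_taylor)
  let ?D = "{b. weight ?\<nu> a (taylor f) b = Fin (nsmul n x)}"
  have "?D \<subseteq> {..degree f}"
  proof
    fix b assume "b \<in> ?D"
    then have "\<nu> (hasse_deriv b f) \<noteq> Infty"
      using n by (auto simp: weight_def hasse_deriv_conv_taylor nsmul_Infty)
    then show "b \<in> {..degree f}"
      using hasse_deriv_beyond[of f b] valuation_0[OF \<nu>] by (cases "b \<le> degree f") auto
  qed
  then have D: "finite ?D" by (rule finite_subset) simp
  \<comment> \<open>The bound \<open>\<epsilon> f = a / n\<close> is attained in degree \<open>n > 0\<close>, hence \<open>d > 0\<close>.\<close>
  define d where "d = Max ?D"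
  have d: "d \<in> ?D" "d > 0"
    using Max_in[OF D] Max_ge[OF D, of n] wn n unfolding d_def by auto
  have top_f: "top_weight ?\<nu> a (taylor f) (nsmul n x) d"
    unfolding top_weight_def
  proof (intro conjI allI impI)
    show ge: "Fin (nsmul n x) \<le> weight ?\<nu> a (taylor f) b" for b
      by (rule weight_taylor_ge[OF \<nu> n x]) (simp add: eps_a)
    fix b assume "d < b"
    then have "b \<notin> ?D" using Max_ge[OF D, of b] by (auto simp: d_def)
    then show "Fin (nsmul n x) < weight ?\<nu> a (taylor f) b"
      using ge[of b] by (simp add: order.order_iff_strict eq_commute)
  qed (use d in simp)
  have top_small: "top_weight ?\<nu> a (taylor g) (nsmul n u) 0"
    if g: "degree g < degree f" "\<nu> g = Fin u" for g u
    unfolding top_weight_def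
  proof (intro conjI allI impI)
    have gt: "Fin (nsmul n u) < weight ?\<nu> a (taylor g) b" if "0 < b" for b
      using smaller[of g] g that by (intro weight_taylor_gt[OF \<nu> n g(2)]) (simp_all add: eps_a)
    then show "0 < b \<Longrightarrow> Fin (nsmul n u) < weight ?\<nu> a (taylor g) b" for b .
    show "weight ?\<nu> a (taylor g) 0 = Fin (nsmul n u)"
      by (rule weight_taylor_0[OF \<nu> n g(2)])
    then show "Fin (nsmul n u) \<le> weight ?\<nu> a (taylor g) b" for b
      using gt[of b] by (cases "b = 0") auto
  qed
  \<comment> \<open>Vanishing coefficients are left out because \<open>top_weight\<close> describes finite values.\<close>
  let ?c = "adic_coeff f Q"
  let ?I = "{s. s \<le> degree Q \<and> ?c s \<noteq> 0}"
  have deg_c: "degree (?c s) < degree f" for s by (rule degree_adic_coeff[OF f(1)])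
  define u where "u = (\<lambda>s. the_fin (\<nu> (?c s)))"
  have u: "\<nu> (?c s) = Fin (u s)" if "s \<in> ?I" for s
    using finite[of "?c s"] deg_c[of s] f(2) that by (cases "\<nu> (?c s)") (auto simp: u_def)
  have expansion: "Q = (\<Sum>s\<in>?I. ?c s * f ^ s)"
    by (subst adic_expansion[OF f(1), of Q], rule sum.mono_neutral_right) auto
  have term_ge: "\<nu> Q \<le> \<nu> (?c s * f ^ s)" if s: "s \<in> ?I" for s
  proof -
    have "nsmul n z \<le> nsmul n (u s) + nsmul s (nsmul n x)"
    proof (rule top_weight_sum_ge[OF vn, where a = a and I = ?I and e = "\<lambda>s. s * d"
            and F = "\<lambda>s. taylor (?c s * f ^ s)" and i = s
            and c = "\<lambda>s. nsmul n (u s) + nsmul s (nsmul n x)"])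
      show "finite ?I" by simp
      show "inj_on (\<lambda>s. s * d) ?I" using d(2) by (auto simp: inj_on_def)
      show "s \<in> ?I" by (rule s)
      show "top_weight ?\<nu> a (taylor (?c s * f ^ s)) (nsmul n (u s) + nsmul s (nsmul n x)) (s * d)"
        if "s \<in> ?I" for s
        using top_weight_mult[OF vn top_small[OF deg_c u[OF that]] top_weight_power[OF vn top_f]]
        by (simp add: taylor_mult taylor_power)
      fix b
      have "Fin (nsmul n z) \<le> weight ?\<nu> a (taylor Q) b"
        using eps eps_a by (intro weight_taylor_ge[OF \<nu> n z]) simp
      then show "Fin (nsmul n z) \<le> weight ?\<nu> a (\<Sum>s\<in>?I. taylor (?c s * f ^ s)) b"
        using expansion taylor_sum[of "\<lambda>s. ?c s * f ^ s" ?I] by simp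
    qed
    also have "\<dots> = nsmul n (u s + nsmul s x)"
      by (simp add: nsmul_distrib nsmul_nsmul mult.commute)
    finally have "z \<le> u s + nsmul s x" using n by (simp add: nsmul_le_iff)
    then show ?thesis
      using u[OF s] by (simp add: z x val_mult[OF \<nu>] val_power[OF \<nu>] nsmul_Fin)
  qed
  have "\<nu> Q \<le> \<mu> (\<Sum>s\<in>?I. ?c s * f ^ s)"
  proof (rule val_sum_ge[OF \<mu>])
    fix s assume "s \<in> ?I"
    then have "\<nu> Q \<le> \<nu> (?c s * f ^ s)" by (rule term_ge)
    also have "\<dots> = \<mu> (?c s * f ^ s)"
      using agree[of "?c s"] agree[of f] deg_c[of s] f
      by (simp add: val_mult[OF \<nu>] val_mult[OF \<mu>] val_power[OF \<nu>] val_power[OF \<mu>])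
    finally show "\<nu> Q \<le> \<mu> (?c s * f ^ s)" .
  qed
  then show False using less expansion by simp
qed


section \<open>Continuous MacLane chains below a valuation\<close>

lemma degree_diff_monic:
  fixes p q :: "'k :: field poly"
  assumes "lead_coeff p = 1" "lead_coeff q = 1" "degree p = degree q" "degree p > 0"
  shows "degree (p - q) < degree p"
proof -
  have "degree (p - q) \<le> degree p" using assms by (intro degree_diff_le) auto
  moreover have "degree (p - q) \<noteq> degree p"
  proof
    assume "degree (p - q) = degree p"
    moreover have "coeff (p - q) (degree p) = 0" using assms by simp
    ultimately show False using assms(4) leading_coeff_0_iff[of "p - q"] by auto
  qed
  ultimately show ?thesis by simp
qed

context
  fixes \<rho> :: "nat \<Rightarrow> 'k :: field poly \<Rightarrow> 'g :: linordered_ab_group_add with_infty"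
    and \<chi> :: "nat \<Rightarrow> 'k poly" and \<beta> :: "nat \<Rightarrow> 'g" and m :: nat
    and \<nu> :: "'k poly \<Rightarrow> 'g with_infty"
  assumes chain: "continuous_MacLane_chain \<rho> \<chi> \<beta> m"
    and v: "valuation \<nu>"
    and below: "\<And>i. val_less (\<rho> i) \<nu>"
begin

lemma chain_valuation: "valuation (\<rho> i)"
  using chain by (simp add: continuous_MacLane_chain_def)

lemma
  shows chain_KP: "\<chi> (Suc i) \<in> KP (\<rho> i)"
    and chain_gt: "\<rho> i (\<chi> (Suc i)) < Fin (\<beta> (Suc i))"
    and chain_augmentation: "\<rho> (Suc i) = augmentation (\<rho> i) (\<chi> (Suc i)) (\<beta> (Suc i))"
    and chain_degree: "degree (\<chi> (Suc i)) = m"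
    and chain_not_val_dvd: "\<not> val_dvd (\<rho> (Suc i)) (\<chi> (Suc (Suc i))) (\<chi> (Suc i))"
proof -
  have "\<chi> (Suc i) \<in> KP (\<rho> (Suc i - 1)) \<and> Fin (\<beta> (Suc i)) > \<rho> (Suc i - 1) (\<chi> (Suc i)) \<and>
      \<rho> (Suc i) = augmentation (\<rho> (Suc i - 1)) (\<chi> (Suc i)) (\<beta> (Suc i)) \<and>
      degree (\<chi> (Suc i)) = m \<and> \<not> val_dvd (\<rho> (Suc i)) (\<chi> (Suc i + 1)) (\<chi> (Suc i))"
    using chain unfolding continuous_MacLane_chain_def by (metis le_add1 plus_1_eq_Suc)
  then show "\<chi> (Suc i) \<in> KP (\<rho> i)" "\<rho> i (\<chi> (Suc i)) < Fin (\<beta> (Suc i))"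
    "\<rho> (Suc i) = augmentation (\<rho> i) (\<chi> (Suc i)) (\<beta> (Suc i))" "degree (\<chi> (Suc i)) = m"
    "\<not> val_dvd (\<rho> (Suc i)) (\<chi> (Suc (Suc i))) (\<chi> (Suc i))"
    unfolding diff_Suc_1 Suc_eq_plus1[symmetric] by blast+
qed

lemma chain_monic: "lead_coeff (\<chi> (Suc i)) = 1"
  by (rule KP_lead_coeff[OF chain_valuation chain_KP])

lemma chain_degree_pos: "m > 0"
  using KP_degree_pos[OF chain_valuation chain_KP[of 0]] by (simp add: chain_degree)

lemma chain_le: "\<rho> i f \<le> \<nu> f"
  using below[of i] by (simp add: val_less_def val_le_def)

lemma chain_value: "\<rho> (Suc i) (\<chi> (Suc i)) = Fin (\<beta> (Suc i))"
  using augmentation_translate[OF chain_valuation[of i], of "\<chi> (Suc i)" 0 "\<beta> (Suc i)"]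
    chain_degree_pos
  by (simp add: chain_degree chain_augmentation[symmetric] valuation_0[OF chain_valuation]
      min_absorb2)

text \<open>
  Each step raises the value of a key polynomial of degree \<open>m\<close>, and \<open>\<nu>\<close> lies above the next step.
\<close>
lemma chain_agree:
  assumes "degree f < m"
  shows "\<rho> i f = \<nu> f"
proof (rule KP_small_agree[OF chain_valuation v chain_le chain_KP])
  show "\<rho> i (\<chi> (Suc i)) < \<nu> (\<chi> (Suc i))"
    using chain_gt[of i] chain_le[of "Suc i" "\<chi> (Suc i)"] by (simp add: chain_value)
qed (simp add: assms chain_degree)

lemma chain_monic_value:
  assumes "lead_coeff \<phi> = 1" "degree \<phi> = m"
  shows "\<rho> (Suc i) \<phi> = min (\<nu> (\<phi> - \<chi> (Suc i))) (Fin (\<beta> (Suc i)))"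
proof -
  have "degree (\<phi> - \<chi> (Suc i)) < m"
    using degree_diff_monic[OF assms(1) chain_monic[of i]] assms(2) chain_degree_pos
    by (simp add: chain_degree)
  then show ?thesis
    using augmentation_translate[OF chain_valuation[of i], of "\<chi> (Suc i)" "\<phi> - \<chi> (Suc i)" "\<beta> (Suc i)"]
      chain_degree_pos
    by (simp add: chain_degree chain_augmentation[symmetric] chain_agree)
qed

text \<open>
  A smaller value of the difference \<open>h\<close> would make \<open>h\<close> and \<open>\<chi> (i + 2)\<close> have the same initial
  form, although \<open>h\<close> is shorter; a larger one would make \<open>\<chi> (i + 1)\<close> and \<open>\<chi> (i + 2)\<close> have the same
  initial form, which the definition of the chain excludes.
\<close>
lemma chain_increment: "\<nu> (\<chi> (Suc (Suc i)) - \<chi> (Suc i)) = Fin (\<beta> (Suc i))"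
proof -
  let ?h = "\<chi> (Suc (Suc i)) - \<chi> (Suc i)"
  note v' = chain_valuation[of "Suc i"]
  have deg: "degree ?h < m"
    using degree_diff_monic[OF chain_monic[of "Suc i"] chain_monic[of i]] chain_degree_pos
    by (simp add: chain_degree)
  have "\<rho> (Suc i) ((- 1) * \<chi> (Suc (Suc i)) + ?h) \<le> \<rho> (Suc i) ?h"
    using deg by (intro KP_remainder_le[OF v' chain_KP]) (simp add: chain_degree)
  then have "Fin (\<beta> (Suc i)) \<le> \<rho> (Suc i) ?h"
    by (simp add: valuation_minus[OF v'] chain_value)
  moreover have "\<not> Fin (\<beta> (Suc i)) < \<rho> (Suc i) ?h"
  proof
    assume "Fin (\<beta> (Suc i)) < \<rho> (Suc i) ?h"
    then have "\<rho> (Suc i) (\<chi> (Suc i)) < \<rho> (Suc i) (\<chi> (Suc i) - 1 * \<chi> (Suc (Suc i)))"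
      by (simp add: chain_value val_diff_commute[OF v', of "\<chi> (Suc i)"])
    then show False using val_dvdI[OF v'] chain_not_val_dvd by blast
  qed
  ultimately show ?thesis by (simp add: chain_agree[OF deg] order.order_iff_strict)
qed

lemma chain_next_value: "\<rho> (Suc i) (\<chi> (Suc (Suc i))) = Fin (\<beta> (Suc i))"
  using chain_monic_value[OF chain_monic[of "Suc i"] chain_degree, of i]
  by (simp add: chain_increment)

lemma chain_increasing: "\<beta> (Suc i) < \<beta> (Suc (Suc i))"
  using chain_gt[of "Suc i"] by (simp add: chain_next_value)

text \<open>
  The later polynomial has a larger value than \<open>\<beta> (i + 1)\<close>, the value of the difference.
\<close>
lemma chain_value_above: "\<nu> (\<chi> (Suc i)) = Fin (\<beta> (Suc i))"
proof -
  have "Fin (\<beta> (Suc i)) < Fin (\<beta> (Suc (Suc i)))" using chain_increasing by simp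
  also have "\<dots> \<le> \<nu> (\<chi> (Suc (Suc i)))"
    using chain_le[of "Suc (Suc i)" "\<chi> (Suc (Suc i))"] by (simp add: chain_value)
  finally have "\<nu> (- (\<chi> (Suc (Suc i)) - \<chi> (Suc i)) + \<chi> (Suc (Suc i))) =
      \<nu> (- (\<chi> (Suc (Suc i)) - \<chi> (Suc i)))"
    by (intro val_add_eq[OF v]) (simp only: valuation_minus[OF v] chain_increment)
  then show ?thesis by (simp add: val_diff_commute[OF v, of "\<chi> (Suc i)"] chain_increment)
qed

lemma chain_eq_truncation: "\<rho> (Suc i) = truncation \<nu> (\<chi> (Suc i))"
  unfolding chain_augmentation
  using augmentation_eq_truncation[OF v _ chain_value_above, of i "\<rho> i"] chain_degree_pos
  by (simp add: chain_degree chain_agree)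

text \<open>
  If \<open>\<rho> i\<close> has reached \<open>\<nu>\<close> on \<open>\<phi>\<close>, it agrees with \<open>\<nu>\<close> on all terms of \<open>\<phi>\<close>-expansions, because the
  coefficients have degree below \<open>m\<close>. This yields both the monotonicity of the chain and, for stable
  \<open>\<phi>\<close>, the comparison of the truncation at \<open>\<phi>\<close> with the chain.
\<close>
lemma truncation_le_chain:
  assumes "degree \<phi> = m" "\<rho> i \<phi> = \<nu> \<phi>"
  shows "truncation \<nu> \<phi> f \<le> \<rho> i f"
proof (rule truncation_le[OF v chain_valuation])
  show pos: "degree \<phi> > 0" using assms chain_degree_pos by simp
  show "\<nu> (adic_coeff \<phi> f s * \<phi> ^ s) \<le> \<rho> i (adic_coeff \<phi> f s * \<phi> ^ s)" for s
    using assms degree_adic_coeff[OF pos, of f s]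
    by (simp add: val_mult[OF v] val_mult[OF chain_valuation] val_power[OF v]
        val_power[OF chain_valuation] chain_agree)
qed

lemma chain_mono:
  assumes "i \<le> j"
  shows "\<rho> (Suc i) f \<le> \<rho> (Suc j) f"
proof -
  have "\<rho> (Suc i) f \<le> \<rho> (Suc (Suc i)) f" for i
  proof -
    have "\<rho> (Suc (Suc i)) (\<chi> (Suc i)) = min (Fin (\<beta> (Suc i))) (Fin (\<beta> (Suc (Suc i))))"
      using chain_monic_value[OF chain_monic[of i] chain_degree, of "Suc i"]
        val_diff_commute[OF v, of "\<chi> (Suc i)"] chain_increment[of i] by simp
    also have "\<dots> = \<nu> (\<chi> (Suc i))"
      using chain_increasing[of i] by (simp add: chain_value_above min_absorb1)
    finally show ?thesis
      unfolding chain_eq_truncation[of i] by (rule truncation_le_chain[OF chain_degree])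
  qed
  then show ?thesis using lift_Suc_mono_le[of "\<lambda>i. \<rho> (Suc i) f" i j] assms by blast
qed

text \<open>
  Write \<open>f\<close> as the sum of \<open>a s * \<chi> ^ s\<close>, with \<open>\<chi>\<close> the key polynomial of the step from \<open>\<rho> (i + 1)\<close> to
  \<open>\<rho> (i + 2)\<close>. The step strictly raises the value of each term with \<open>s > 0\<close>. If both valuations take
  the value \<open>c\<close> at \<open>f\<close>, then no term had a value below \<open>c\<close> before the step, so only the term
  \<open>s = 0\<close> can have value \<open>c\<close> after it. That term dominates for \<open>\<nu>\<close> as well.
\<close>
lemma stable_iff_attains:
  "stable \<rho> f \<longleftrightarrow> (\<exists>N. \<forall>i\<ge>N. \<rho> (Suc i) f = \<nu> f)"
proof
  assume "stable \<rho> f"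
  then obtain N where N: "\<And>i. i \<ge> N \<Longrightarrow> \<rho> i f = \<rho> N f"
    unfolding stable_def by blast
  have "\<rho> (Suc i) f = \<nu> f" if "i \<ge> N" for i
  proof (cases "\<rho> (Suc i) f")
    case Infty
    then show ?thesis using chain_le[of "Suc i" f] by (cases "\<nu> f") auto
  next
    case (Fin c)
    let ?\<chi> = "\<chi> (Suc (Suc i))"
    have pos: "degree ?\<chi> > 0" using chain_degree_pos by (simp add: chain_degree)
    let ?a = "adic_coeff ?\<chi> f"
    have deg: "degree (?a s) < m" for s
      using degree_adic_coeff[OF pos, of f s] by (simp add: chain_degree)
    have next_eq: "\<rho> (Suc (Suc i)) f = Fin c"
      using N[of "Suc i"] N[of "Suc (Suc i)"] that Fin by simp
    have gt: "Fin c < \<nu> (?a s) + Fin (nsmul s (\<beta> (Suc (Suc i))))" if s: "s > 0" for s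
    proof -
      have "\<rho> (Suc i) f \<le> \<rho> (Suc i) (?a s * ?\<chi> ^ s)"
        by (rule KP_expansion_le[OF chain_valuation chain_KP])
      then have "Fin c \<le> \<nu> (?a s) + Fin (nsmul s (\<beta> (Suc i)))"
        by (simp add: Fin val_mult[OF chain_valuation] val_power[OF chain_valuation]
            chain_agree[OF deg] chain_next_value nsmul_Fin)
      moreover have "nsmul s (\<beta> (Suc i)) < nsmul s (\<beta> (Suc (Suc i)))"
        by (rule nsmul_strict_mono[OF chain_increasing s])
      ultimately show ?thesis by (cases "\<nu> (?a s)") (auto intro: order_le_less_trans)
    qed
    obtain s where "\<rho> (Suc (Suc i)) f = \<rho> (Suc i) (?a s) + Fin (nsmul s (\<beta> (Suc (Suc i))))"
      unfolding chain_augmentation[of "Suc i"]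
      by (rule augmentation_attained[OF chain_valuation pos])
    then have s: "Fin c = \<nu> (?a s) + Fin (nsmul s (\<beta> (Suc (Suc i))))"
      by (simp add: next_eq chain_agree[OF deg])
    then have "s = 0" using gt[of s] by (cases "s = 0") auto
    then have a0: "\<nu> (?a 0) = Fin c" using s by (simp add: zero_with_infty_def[symmetric])
    have "Fin c < \<nu> (\<Sum>s\<in>{..degree f} - {0}. ?a s * ?\<chi> ^ s)"
      using gt
      by (intro val_sum_gt[OF v])
        (simp add: val_mult[OF v] val_power[OF v] chain_value_above nsmul_Fin)
    then have "\<nu> (?a 0 + (\<Sum>s\<in>{..degree f} - {0}. ?a s * ?\<chi> ^ s)) = Fin c"
      using val_add_eq[OF v] a0 by metis
    moreover have "f = ?a 0 + (\<Sum>s\<in>{..degree f} - {0}. ?a s * ?\<chi> ^ s)"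
      by (subst adic_expansion[OF pos, of f], subst sum.remove[of _ 0]) simp_all
    ultimately show ?thesis using Fin by simp
  qed
  then show "\<exists>N. \<forall>i\<ge>N. \<rho> (Suc i) f = \<nu> f" by blast
next
  assume "\<exists>N. \<forall>i\<ge>N. \<rho> (Suc i) f = \<nu> f"
  then obtain N where N: "\<And>i. i \<ge> N \<Longrightarrow> \<rho> (Suc i) f = \<nu> f" by blast
  have "\<rho> i f = \<nu> f" if "i \<ge> Suc N" for i
    using N[of "i - 1"] that by (cases i) auto
  then show "stable \<rho> f" unfolding stable_def by (metis order_refl)
qed

lemma not_stable_less:
  assumes "\<not> stable \<rho> f"
  shows "\<rho> (Suc i) f < \<nu> f"
proof (rule ccontr)
  assume "\<not> ?thesis"
  then have "\<nu> f \<le> \<rho> (Suc j) f" if "i \<le> j" for j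
    using chain_mono[OF that, of f] by simp
  then have "\<rho> (Suc j) f = \<nu> f" if "i \<le> j" for j
    using that chain_le[of "Suc j" f] by (simp add: antisym)
  then show False using assms stable_iff_attains by blast
qed

lemma chain_abstract_key_polynomial: "abstract_key_polynomial \<nu> (\<chi> (Suc 0))"
proof (rule abstract_key_polynomialI[OF chain_valuation[of 0] v chain_monic])
  show "degree (\<chi> (Suc 0)) > 0" using chain_degree_pos by (simp add: chain_degree)
  show agree: "\<rho> 0 f = \<nu> f" if "degree f < degree (\<chi> (Suc 0))" for f
    using that by (simp add: chain_degree chain_agree)
  show "\<nu> f \<noteq> Infty" if "f \<noteq> 0" "degree f < degree (\<chi> (Suc 0))" for f
    using KP_small_finite[OF chain_valuation chain_KP that] agree[OF that(2)] by simp
  show "\<rho> 0 (\<chi> (Suc 0)) < \<nu> (\<chi> (Suc 0))"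
    using chain_gt[of 0] by (simp add: chain_value_above)
qed

text \<open>
  Since \<open>\<rho> 1\<close> agrees with \<open>\<nu>\<close> below degree \<open>m\<close>, the degree of \<open>\<Phi>\<close> is at least \<open>m\<close>; the polynomials
  \<open>\<chi> i\<close> with \<open>i \<ge> 2\<close> attain it, as \<open>\<beta>\<close> increases.
\<close>
lemma chain_in_Phi: "\<chi> (Suc (Suc i)) \<in> Phi (\<rho> (Suc 0)) \<nu>"
  and degree_Phi: "\<phi> \<in> Phi (\<rho> (Suc 0)) \<nu> \<Longrightarrow> degree \<phi> = m"
  and deg_Phi_chain: "deg_Phi (\<rho> (Suc 0)) \<nu> = m"
proof -
  have less: "\<rho> (Suc 0) (\<chi> (Suc (Suc i))) < \<nu> (\<chi> (Suc (Suc i)))" for i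
  proof -
    have "\<rho> (Suc 0) (\<chi> (Suc (Suc i))) \<le> \<rho> (Suc i) (\<chi> (Suc (Suc i)))"
      by (rule chain_mono) simp
    also have "\<dots> < \<nu> (\<chi> (Suc (Suc i)))"
      by (simp add: chain_next_value chain_value_above chain_increasing)
    finally show ?thesis .
  qed
  have ge: "m \<le> degree g" if "\<rho> (Suc 0) g < \<nu> g" for g
    using chain_agree[of g "Suc 0"] that by (cases "degree g < m") auto
  show "\<chi> (Suc (Suc i)) \<in> Phi (\<rho> (Suc 0)) \<nu>"
    using less ge chain_monic[of "Suc i"] by (simp add: Phi_def chain_degree)
  show "degree \<phi> = m" if "\<phi> \<in> Phi (\<rho> (Suc 0)) \<nu>"
  proof (rule antisym)
    have "degree \<phi> \<le> degree g" if "lead_coeff g = 1" "\<rho> (Suc 0) g < \<nu> g" for g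
      using \<open>\<phi> \<in> _\<close> that unfolding Phi_def by simp
    from this[OF chain_monic less] show "degree \<phi> \<le> m" by (simp add: chain_degree)
    show "m \<le> degree \<phi>" using that by (intro ge) (simp add: Phi_def)
  qed
  show "deg_Phi (\<rho> (Suc 0)) \<nu> = m"
    unfolding deg_Phi_def
  proof (rule Least_equality)
    show "\<exists>\<phi>. lead_coeff \<phi> = 1 \<and> \<rho> (Suc 0) \<phi> < \<nu> \<phi> \<and> degree \<phi> = m"
      by (intro exI[of _ "\<chi> (Suc (Suc 0))"] conjI less chain_monic chain_degree)
  qed (auto dest: ge)
qed

text \<open>
  A stable \<open>\<phi>\<close> of degree \<open>m\<close> has its value reached by some \<open>\<rho> i\<close>, and \<open>\<rho> i \<phi> \<le> \<beta> i\<close> because \<open>\<phi>\<close> is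
  \<open>\<chi> i\<close> plus a shorter polynomial. The value of \<open>\<chi> (i + 1)\<close> is larger.
\<close>
lemma Phi_values_no_maximum:
  assumes stable: "\<And>\<phi>. degree \<phi> = m \<Longrightarrow> stable \<rho> \<phi>"
  shows "\<not> (\<exists>\<alpha> \<in> \<nu> ` Phi (\<rho> (Suc 0)) \<nu>. \<forall>\<gamma> \<in> \<nu> ` Phi (\<rho> (Suc 0)) \<nu>. \<gamma> \<le> \<alpha>)"
proof
  assume "\<exists>\<alpha> \<in> \<nu> ` Phi (\<rho> (Suc 0)) \<nu>. \<forall>\<gamma> \<in> \<nu> ` Phi (\<rho> (Suc 0)) \<nu>. \<gamma> \<le> \<alpha>"
  then obtain \<phi> where \<phi>: "\<phi> \<in> Phi (\<rho> (Suc 0)) \<nu>"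
    and max: "\<And>\<psi>. \<psi> \<in> Phi (\<rho> (Suc 0)) \<nu> \<Longrightarrow> \<nu> \<psi> \<le> \<nu> \<phi>" by blast
  have \<phi>': "lead_coeff \<phi> = 1" "degree \<phi> = m"
    using \<phi> degree_Phi[OF \<phi>] unfolding Phi_def by blast+
  obtain N where "\<forall>i\<ge>N. \<rho> (Suc i) \<phi> = \<nu> \<phi>"
    using stable[OF \<phi>'(2)] unfolding stable_iff_attains ..
  then have "\<nu> \<phi> = \<rho> (Suc N) \<phi>" by simp
  also have "\<dots> \<le> Fin (\<beta> (Suc N))" by (simp add: chain_monic_value[OF \<phi>'])
  also have "\<dots> < \<nu> (\<chi> (Suc (Suc N)))" by (simp add: chain_value_above chain_increasing)
  finally show False using max[OF chain_in_Phi[of N]] by simp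
qed

end


section \<open>Limit key polynomials\<close>

theorem proposition3p2:
  fixes \<rho> :: "nat \<Rightarrow> 'k :: field poly \<Rightarrow> 'g :: linordered_ab_group_add with_infty"
    and \<chi> :: "nat \<Rightarrow> 'k poly" and \<beta> :: "nat \<Rightarrow> 'g" and m :: nat
    and \<nu> :: "'k poly \<Rightarrow> 'g with_infty"
  assumes "essential_chain \<rho> \<chi> \<beta> m"
    and "valuation \<nu>"
    and "\<And>i. val_less (\<rho> i) \<nu>"
  shows "\<forall>Q \<in> MLV_limit_key_polynomials \<rho>. abstract_limit_key_polynomial \<nu> Q"
proof
  fix Q assume Q: "Q \<in> MLV_limit_key_polynomials \<rho>"
  have chain: "continuous_MacLane_chain \<rho> \<chi> \<beta> m" and m: "enat m < m_infty \<rho>"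
    using assms(1) by (auto simp: essential_chain_def)
  note facts = chain assms(2,3)
  let ?\<Phi> = "Phi (\<rho> (Suc 0)) \<nu>"
  have small_stable: "stable \<rho> f" if "enat (degree f) < m_infty \<rho>" for f
  proof (rule ccontr)
    assume "\<not> stable \<rho> f"
    then have "m_infty \<rho> \<le> enat (degree f)" unfolding m_infty_def by (intro INF_lower) simp
    then show False using that by simp
  qed
  have monic: "lead_coeff Q = 1" and unstable: "\<not> stable \<rho> Q"
    and deg: "enat (degree Q) = m_infty \<rho>"
    using Q by (auto simp: MLV_limit_key_polynomials_def)
  have K2: "\<not> (\<exists>\<alpha> \<in> \<nu> ` ?\<Phi>. \<forall>\<gamma> \<in> \<nu> ` ?\<Phi>. \<gamma> \<le> \<alpha>)"
    using m by (intro Phi_values_no_maximum[OF facts] small_stable) simp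
  have K3: "truncation \<nu> \<phi> Q < \<nu> Q" if "\<phi> \<in> ?\<Phi>" for \<phi>
  proof -
    have \<phi>: "degree \<phi> = m" by (rule degree_Phi[OF facts that])
    then obtain N where "\<rho> (Suc N) \<phi> = \<nu> \<phi>"
      using small_stable[of \<phi>] m stable_iff_attains[OF facts] by auto
    then have "truncation \<nu> \<phi> Q \<le> \<rho> (Suc N) Q" by (rule truncation_le_chain[OF facts \<phi>])
    also have "\<dots> < \<nu> Q" by (rule not_stable_less[OF facts unstable])
    finally show ?thesis .
  qed
  have K4: "degree Q \<le> degree f" if f: "\<And>\<phi>. \<phi> \<in> ?\<Phi> \<Longrightarrow> truncation \<nu> \<phi> f < \<nu> f" for f
  proof (rule ccontr)
    assume "\<not> ?thesis"
    then have "stable \<rho> f" by (intro small_stable) (simp flip: deg)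
    then obtain N where "\<And>i. i \<ge> N \<Longrightarrow> \<rho> (Suc i) f = \<nu> f"
      using stable_iff_attains[OF facts] by blast
    then have "truncation \<nu> (\<chi> (Suc (Suc N))) f = \<nu> f"
      by (simp flip: chain_eq_truncation[OF facts])
    then show False using f[OF chain_in_Phi[OF facts, of N]] by simp
  qed
  show "abstract_limit_key_polynomial \<nu> Q"
    unfolding abstract_limit_key_polynomial_def Let_def
    using monic chain_abstract_key_polynomial[OF facts] assms(3)[of "Suc 0"]
      chain_degree[OF facts, of 0] deg_Phi_chain[OF facts] K2 K3 K4
    by (intro conjI exI[of _ "\<chi> (Suc 0)"])
      (simp_all flip: chain_eq_truncation[OF facts])
qed

end
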